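(* Let $k\ge2$ and $n\ge n_1(k)$ be integers, and for $\lambda\in\Gamma_{n,k}$ let $$A_\lambda f(\mathbf l)=\frac1{P(\lambda)}\sum_{\substack{\mathbf p\ \text{prime vector}\\ p_1^k+\dots+p_n^k=\lambda}}(\log p_1)\cdots(\log p_n)\,f(\mathbf p-\mathbf l),\qquad \mathbf l\in\mathbb Z^n .$$ Let $1<p<2$ and $1/p+1/p'=1$. Below, suprema are over $\lambda\in\Gamma_{n,k}$ in the indicated range. (i) If $k\ge3$, then for every $B>0$ there is a constant $C_{B,p,n,k}$, independent of $\Lambda$ and $f$, such that for all large $\Lambda$ and all $f\in\ell^p(\mathbb Z^n)$, $$\Big\|\sup_{\Lambda\le\lambda<2\Lambda}|A_\lambda f|\Big\|_{\ell^{p'}(\mathbb Z^n)}\le C_{B,p,n,k}\,\Lambda^{(1-\frac nk)(\frac2p-1)}(\log\Lambda)^{-B}\,\|f\|_{\ell^p(\mathbb Z^n)} .$$ (ii) If $k=2$, then there is a constant $C_{p,n}$, independent of $\Lambda$ and $f$, such that for all large $\Lambda$ and all $f\in\ell^p(\mathbb Z^n)$, $$\Big\|\sup_{\Lambda\le\lambda<2\Lambda}|A_\lambda f|\Big\|_{\ell^{p'}(\mathbb Z^n)}\le C_{p,n}\,\Lambda^{(1-\frac n2)(\frac2p-1)}(\log\Lambda)^{n}\,\|f\|_{\ell^p(\mathbb Z^n)} .$$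
   Context: A prime vector is $\mathbf p=(p_1,\dots,p_n)$ with all coordinates prime; $P(\lambda)=\sum(\log p_1)\cdots(\log p_n)$, the sum over prime vectors with $p_1^k+\dots+p_n^k=\lambda$. $\Gamma_{n,k}\subset\mathbb N$ is a fixed infinite arithmetic progression along which Hua's asymptotic $P(\lambda)\sim\mathfrak S_{n,k}(\lambda)\lambda^{n/k-1}$ holds as $\lambda\to\infty$, with $\mathfrak S_{n,k}(\lambda)$ bounded above and below by positive constants independent of $\lambda\in\Gamma_{n,k}$. Let $n_0(k)=2^k+1$ for $k=2,3,4$, and for $k\ge5$, $n_0(k)=k^2+3-\max_{1\le j\le k-1}\left\lceil\frac{kj-\min(2^j,j^2+j)}{k-j+1}\right\rceil$. The threshold $n_1(k)\ge n_0(k)$ is the one from earlier work of Anderson, Cook, Hughes and Kumchev (``On the Ergodic Waring--Goldbach Problem''); $n_1(2)=7$. It is the dimension threshold with the following property: for every $n\ge n_1(k)$ and every $B>0$ there is $C=C(B)>0$ such that, for all large $\Lambda$, with $E_\lambda$ the convolution operator defined below, $$\Big\|\sup_{\Lambda\le\lambda<2\Lambda,\ \lambda\in\Gamma_{n,k}}|E_\lambda f|\Big\|_{\ell^2(\mathbb Z^n)}\lesssim(\log\Lambda)^{-B}\|f\|_{\ell^2(\mathbb Z^n)}.$$ Here $\widehat{E_\lambda}=\widehat{\sigma_\lambda}-\widehat{M_\lambda}$, where $\sigma_\lambda(\mathbf x)=\frac1{P(\lambda)}(\log x_1)\cdots(\log x_n)$ if all $x_i$ are prime and $x_1^k+\dots+x_n^k=\lambda$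 (and $0$ otherwise), and $$\widehat{M_\lambda}(\boldsymbol\xi)=\frac{\lambda^{n/k-1}}{P(\lambda)}\sum_{1\le\mathbf q\le Q}\sum_{\mathbf a\in\mathbb U_{\mathbf q}}\mathfrak S(\lambda;\mathbf a,\mathbf q)\,\psi_{N/Q}(\mathbf q\boldsymbol\xi-\mathbf a)\,\widetilde{d\sigma_\lambda}(\boldsymbol\xi-\mathbf a/\mathbf q),\qquad\boldsymbol\xi\in\mathbb T^n,$$ with $\lambda^{1/k}\le N\lesssim\lambda^{1/k}$ ($N$ common to all $\lambda\in[\Lambda,2\Lambda)$) and $Q=(\log N)^C$, understood $1$-periodically in each coordinate of $\boldsymbol\xi$. In this formula: $e(t)=e^{2\pi it}$; $\mathbb U_q=(\mathbb Z/q\mathbb Z)^*$, $\mathbb U_{\mathbf q}=\mathbb U_{q_1}\times\dots\times\mathbb U_{q_n}$; vector products and quotients are coordinatewise and $1\le\mathbf q\le Q$ means $1\le q_i\le Q$ for all $i$; $$g(a,q;b,r)=\frac1{\varphi([q,r])}\sum_{x\in\mathbb U_{[q,r]}}e\Big(\frac{ax^k}q+\frac{bx}r\Big),\qquad \mathfrak S(\lambda;\mathbf a,\mathbf q)=\sum_{q=1}^\infty\sum_{a\in\mathbb U_q}e(-\lambda a/q)\prod_{i=1}^ng(a,q;a_i,q_i),$$ with $[q,r]=\mathrm{lcm}[q,r]$ and $\varphi$ Euler's function; $\psi$ is a fixed smooth function with $\mathbf 1_{[-1,1]^n}(\mathbf x)\le\psi(\mathbf x)\le\mathbf 1_{[-1,1]^n}(\mathbf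 x/2)$ and $\psi_t(\mathbf x)=\psi(t\mathbf x)$; $\widetilde{d\sigma_\lambda}$ is the Fourier transform on $\mathbb R^n$ of the continuous $k$-spherical surface measure, $\lambda^{1-n/k}\,\delta(t_1^k+\dots+t_n^k-\lambda)\,d\mathbf t$ on $\{\mathbf t:t_i>0\}$. *)

theory Defs
  imports
    "HOL-Analysis.Analysis"
    "HOL-Number_Theory.Totient"
    "HOL-Library.Landau_Symbols"
begin

text \<open>
  The dimension \<open>n\<close> is a quantified natural number, so vectors are extensional functions on
  \<open>{..<n}\<close>; this is also the underlying set of the product measure \<open>\<Pi>\<^sub>M i\<in>{..<n}. lborel\<close>.
\<close>

definition int_vecs :: "nat \<Rightarrow> (nat \<Rightarrow> int) set" where
  "int_vecs n = {..<n} \<rightarrow>\<^sub>E UNIV"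

definition real_vecs :: "nat \<Rightarrow> (nat \<Rightarrow> real) set" where
  "real_vecs n = {..<n} \<rightarrow>\<^sub>E UNIV"

definition vec_diff :: "nat \<Rightarrow> (nat \<Rightarrow> int) \<Rightarrow> (nat \<Rightarrow> int) \<Rightarrow> nat \<Rightarrow> int" where
  "vec_diff n x y = (\<lambda>i\<in>{..<n}. x i - y i)"

definition ee :: "real \<Rightarrow> complex" where
  "ee t = cis (2 * pi * t)"

definition lp_space :: "nat \<Rightarrow> real \<Rightarrow> ((nat \<Rightarrow> int) \<Rightarrow> 'a::real_normed_vector) set" where
  "lp_space n p = {f. (\<lambda>x. norm (f x) powr p) summable_on int_vecs n}"

definition lp_norm :: "nat \<Rightarrow> real \<Rightarrow> ((nat \<Rightarrow> int) \<Rightarrow> 'a::real_normed_vector) \<Rightarrow> real" where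
  "lp_norm n p f = (\<Sum>\<^sub>\<infinity>x\<in>int_vecs n. norm (f x) powr p) powr (1 / p)"

definition lp_bounded ::
  "nat \<Rightarrow> real \<Rightarrow> real \<Rightarrow> (((nat \<Rightarrow> int) \<Rightarrow> complex) \<Rightarrow> (nat \<Rightarrow> int) \<Rightarrow> real) \<Rightarrow> real \<Rightarrow> bool" where
  "lp_bounded n p q T K \<longleftrightarrow>
     (\<forall>f \<in> lp_space n p. T f \<in> lp_space n q \<and> lp_norm n q (T f) \<le> K * lp_norm n p f)"

text \<open>
  The supremum is over a finite set, which is nonempty for all large \<open>\<Lambda>\<close> when \<open>\<Gamma>\<close> is an infinite
  arithmetic progression.
\<close>

definition dyadic_sup ::
  "nat set \<Rightarrow> real \<Rightarrow> (nat \<Rightarrow> ((nat \<Rightarrow> int) \<Rightarrow> complex) \<Rightarrow> (nat \<Rightarrow> int) \<Rightarrow> complex)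
     \<Rightarrow> ((nat \<Rightarrow> int) \<Rightarrow> complex) \<Rightarrow> (nat \<Rightarrow> int) \<Rightarrow> real" where
  "dyadic_sup \<Gamma> \<Lambda> T f l = (SUP lam\<in>{lam \<in> \<Gamma>. \<Lambda> \<le> real lam \<and> real lam < 2 * \<Lambda>}. cmod (T lam f l))"

definition prime_vecs :: "nat \<Rightarrow> nat \<Rightarrow> nat \<Rightarrow> (nat \<Rightarrow> int) set" where
  "prime_vecs n k lam =
     {x \<in> int_vecs n. (\<forall>i<n. prime (x i)) \<and> (\<Sum>i<n. x i ^ k) = int lam}"

definition log_weight :: "nat \<Rightarrow> (nat \<Rightarrow> int) \<Rightarrow> real" where
  "log_weight n x = (\<Prod>i<n. ln (real_of_int (x i)))"

definition prime_count :: "nat \<Rightarrow> nat \<Rightarrow> nat \<Rightarrow> real" where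
  "prime_count n k lam = (\<Sum>x\<in>prime_vecs n k lam. log_weight n x)"

definition prime_avg ::
  "nat \<Rightarrow> nat \<Rightarrow> nat \<Rightarrow> ((nat \<Rightarrow> int) \<Rightarrow> complex) \<Rightarrow> (nat \<Rightarrow> int) \<Rightarrow> complex" where
  "prime_avg n k lam f l =
     of_real (1 / prime_count n k lam) *
       (\<Sum>x\<in>prime_vecs n k lam. of_real (log_weight n x) * f (vec_diff n x l))"

definition hua_progression :: "nat \<Rightarrow> nat \<Rightarrow> nat set \<Rightarrow> bool" where
  "hua_progression n k \<Gamma> \<longleftrightarrow>
     (\<exists>a d. d > 0 \<and> \<Gamma> = {a + d * m | m. True}) \<and>
     (\<exists>(S :: nat \<Rightarrow> real) c1 c2. 0 < c1 \<and> (\<forall>lam\<in>\<Gamma>. c1 \<le> S lam \<and> S lam \<le> c2) \<and>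
        prime_count n k \<sim>[inf at_top (principal \<Gamma>)]
          (\<lambda>lam. S lam * real lam powr (real n / real k - 1)))"

definition gauss_sum :: "nat \<Rightarrow> nat \<Rightarrow> nat \<Rightarrow> int \<Rightarrow> nat \<Rightarrow> complex" where
  "gauss_sum k a q b r =
     (\<Sum>x\<in>totatives (lcm q r). ee (real a * real x ^ k / real q + real_of_int b * real x / real r))
       / of_nat (totient (lcm q r))"

text \<open>The term for \<open>q = 0\<close> vanishes because \<open>totatives 0 = {}\<close>.\<close>

definition sing_series ::
  "nat \<Rightarrow> nat \<Rightarrow> nat \<Rightarrow> (nat \<Rightarrow> int) \<Rightarrow> (nat \<Rightarrow> nat) \<Rightarrow> complex" where
  "sing_series n k lam b r =
     (\<Sum>q. \<Sum>a\<in>totatives q.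
        ee (- (real lam * real a / real q)) * (\<Prod>i<n. gauss_sum k a q (b i) (r i)))"

text \<open>
  The integral against \<open>\<delta>(t\<^sub>1\<^sup>k + \<dots> + t\<^sub>n\<^sup>k - \<lambda>) dt\<close> over the open positive orthant, with \<open>\<delta>\<close> read as
  the limit of the densities \<open>1/(2\<epsilon>)\<close> on \<open>[-\<epsilon>, \<epsilon>]\<close>.
\<close>

definition delta_integral :: "nat \<Rightarrow> nat \<Rightarrow> real \<Rightarrow> ((nat \<Rightarrow> real) \<Rightarrow> complex) \<Rightarrow> complex" where
  "delta_integral n k lam g =
     Lim (at_right 0) (\<lambda>\<epsilon>. of_real (1 / (2 * \<epsilon>)) *
       (LINT t : {t \<in> real_vecs n. (\<forall>i<n. 0 < t i) \<and> \<bar>(\<Sum>i<n. t i ^ k) - lam\<bar> \<le> \<epsilon>}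
          | (\<Pi>\<^sub>M i\<in>{..<n}. lborel). g t))"

text \<open>
  Fourier transforms carry the character \<open>e(+x\<cdot>\<xi>)\<close>, both on \<open>\<real>\<^sup>n\<close> and on \<open>\<int>\<^sup>n\<close>. This is the sign
  matching \<open>e(b x / r)\<close> in the Gauss sums, and it matters when \<open>k\<close> is odd.
\<close>

definition sphere_ft :: "nat \<Rightarrow> nat \<Rightarrow> nat \<Rightarrow> (nat \<Rightarrow> real) \<Rightarrow> complex" where
  "sphere_ft n k lam \<xi> =
     of_real (real lam powr (1 - real n / real k)) *
       delta_integral n k (real lam) (\<lambda>t. ee (\<Sum>i<n. t i * \<xi> i))"

text \<open>
  Summing over all integer vectors \<open>a\<close> with \<open>a\<^sub>i\<close> coprime to \<open>q\<^sub>i\<close>, rather than over one representative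
  of each residue class, is the \<open>1\<close>-periodization in \<open>\<xi>\<close>: the singular series depends only on
  \<open>a\<^sub>i mod q\<^sub>i\<close>, and replacing \<open>a\<^sub>i\<close> by \<open>a\<^sub>i + q\<^sub>i m\<close> shifts \<open>\<xi>\<^sub>i\<close> by \<open>m\<close>. Only finitely many terms are
  nonzero if \<open>N\<close> and \<open>Q\<close> are positive and \<open>\<psi>\<close> has compact support.
\<close>

definition main_mult ::
  "nat \<Rightarrow> nat \<Rightarrow> ((nat \<Rightarrow> real) \<Rightarrow> real) \<Rightarrow> real \<Rightarrow> real \<Rightarrow> nat \<Rightarrow> (nat \<Rightarrow> real) \<Rightarrow> complex" where
  "main_mult n k \<psi> N Q lam \<xi> =
     of_real (real lam powr (real n / real k - 1) / prime_count n k lam) *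
     (\<Sum>q \<in> {..<n} \<rightarrow>\<^sub>E {q :: nat. 1 \<le> q \<and> real q \<le> Q}.
        \<Sum>\<^sub>\<infinity>a \<in> {a \<in> int_vecs n. \<forall>i<n. coprime (a i) (int (q i))}.
          sing_series n k lam a q
          * of_real (\<psi> (\<lambda>i\<in>{..<n}. N / Q * (real (q i) * \<xi> i - real_of_int (a i))))
          * sphere_ft n k lam (\<lambda>i\<in>{..<n}. \<xi> i - real_of_int (a i) / real (q i)))"

definition main_kernel ::
  "nat \<Rightarrow> nat \<Rightarrow> ((nat \<Rightarrow> real) \<Rightarrow> real) \<Rightarrow> real \<Rightarrow> real \<Rightarrow> nat \<Rightarrow> (nat \<Rightarrow> int) \<Rightarrow> complex" where
  "main_kernel n k \<psi> N Q lam x =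
     (LINT \<xi> : ({..<n} \<rightarrow>\<^sub>E {0..1}) | (\<Pi>\<^sub>M i\<in>{..<n}. lborel).
        main_mult n k \<psi> N Q lam \<xi> * ee (- (\<Sum>i<n. real_of_int (x i) * \<xi> i)))"

definition prime_kernel :: "nat \<Rightarrow> nat \<Rightarrow> nat \<Rightarrow> (nat \<Rightarrow> int) \<Rightarrow> complex" where
  "prime_kernel n k lam x =
     (if x \<in> prime_vecs n k lam then of_real (log_weight n x / prime_count n k lam) else 0)"

definition convolve ::
  "nat \<Rightarrow> ((nat \<Rightarrow> int) \<Rightarrow> complex) \<Rightarrow> ((nat \<Rightarrow> int) \<Rightarrow> complex) \<Rightarrow> (nat \<Rightarrow> int) \<Rightarrow> complex" where
  "convolve n K f l = (\<Sum>\<^sub>\<infinity>x\<in>int_vecs n. K x * f (vec_diff n l x))"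

definition error_op ::
  "nat \<Rightarrow> nat \<Rightarrow> ((nat \<Rightarrow> real) \<Rightarrow> real) \<Rightarrow> real \<Rightarrow> real
     \<Rightarrow> nat \<Rightarrow> ((nat \<Rightarrow> int) \<Rightarrow> complex) \<Rightarrow> (nat \<Rightarrow> int) \<Rightarrow> complex" where
  "error_op n k \<psi> N Q lam =
     convolve n (\<lambda>x. prime_kernel n k lam x - main_kernel n k \<psi> N Q lam x)"

definition partial_deriv :: "nat \<Rightarrow> ((nat \<Rightarrow> real) \<Rightarrow> real) \<Rightarrow> (nat \<Rightarrow> real) \<Rightarrow> real" where
  "partial_deriv i f x = deriv (\<lambda>t. f (x(i := t))) (x i)"

text \<open>\<open>C\<^sup>\<infinity>\<close>: the iterated partial derivatives of all orders exist and are continuous.\<close>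

definition smooth_fun :: "nat \<Rightarrow> ((nat \<Rightarrow> real) \<Rightarrow> real) \<Rightarrow> bool" where
  "smooth_fun n f \<longleftrightarrow>
     (\<forall>js. set js \<subseteq> {..<n} \<longrightarrow>
        continuous_on (real_vecs n) (foldr partial_deriv js f) \<and>
        (\<forall>i<n. \<forall>x\<in>real_vecs n.
           (\<lambda>t. foldr partial_deriv js f (x(i := t))) field_differentiable at (x i)))"

definition cutoff_fun :: "nat \<Rightarrow> ((nat \<Rightarrow> real) \<Rightarrow> real) \<Rightarrow> bool" where
  "cutoff_fun n \<psi> \<longleftrightarrow> smooth_fun n \<psi> \<and>
     (\<forall>x\<in>real_vecs n.
        indicator ({..<n} \<rightarrow>\<^sub>E {-1..1}) x \<le> \<psi> x \<and>
        \<psi> x \<le> indicator ({..<n} \<rightarrow>\<^sub>E {-1..1}) (\<lambda>i\<in>{..<n}. x i / 2))"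

definition admissible_scale :: "nat \<Rightarrow> (real \<Rightarrow> real) \<Rightarrow> bool" where
  "admissible_scale k N \<longleftrightarrow>
     (\<exists>c. \<forall>\<^sub>F \<Lambda> in at_top. \<forall>lam::real. \<Lambda> \<le> lam \<and> lam < 2 * \<Lambda> \<longrightarrow>
        lam powr (1 / real k) \<le> N \<Lambda> \<and> N \<Lambda> \<le> c * lam powr (1 / real k))"

definition n0 :: "nat \<Rightarrow> int" where
  "n0 k = (if k \<le> 4 then 2 ^ k + 1
     else int k ^ 2 + 3 -
       Max ((\<lambda>j. \<lceil>(real k * real j - min (2 ^ j) (real j ^ 2 + real j)) / (real k - real j + 1)\<rceil>)
              ` {1..k - 1}))"

definition error_threshold ::
  "(nat \<Rightarrow> nat \<Rightarrow> nat set) \<Rightarrow> (nat \<Rightarrow> (nat \<Rightarrow> real) \<Rightarrow> real) \<Rightarrow> (real \<Rightarrow> real)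
     \<Rightarrow> nat \<Rightarrow> nat \<Rightarrow> bool" where
  "error_threshold \<Gamma> \<psi> N k m \<longleftrightarrow>
     n0 k \<le> int m \<and>
     (\<forall>n\<ge>m. \<forall>B>0. \<exists>C>0. \<exists>K. \<forall>\<^sub>F \<Lambda> in at_top.
        lp_bounded n 2 2
          (dyadic_sup (\<Gamma> n k) \<Lambda> (error_op n k (\<psi> n) (N \<Lambda>) (ln (N \<Lambda>) powr C)))
          (K * ln \<Lambda> powr (- B)))"

end

theory Submission
  imports Defs "HOL-Real_Asymp.Real_Asymp"
begin

text \<open>
  Write the averaging kernel as main term plus error. On \<open>\<ell>\<^sup>2\<close> the maximal error operator gains any
  power of \<open>log \<Lambda>\<close>, and from \<open>\<ell>\<^sup>1\<close> to \<open>\<ell>\<^sup>\<infinity>\<close> it is bounded by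
  \<open>\<Lambda>\<close> to the power \<open>1 - n/k\<close> times \<open>(log \<Lambda>)\<^sup>n\<close>; interpolation gives the claimed bound for it.
  The kernel of the main term is smaller by a factor of essentially \<open>\<Lambda>\<close>: both the average and
  the error are bounded on \<open>\<ell>\<^sup>2\<close>, so the multiplier of the main term is bounded by 2, while the cutoff
  confines it to a set of measure at most \<open>\<Lambda>\<close> to the power \<open>-n/k\<close> up to logarithms. Since averages
  over prime vectors are local at scale \<open>\<Lambda>\<close> to the power \<open>1/k\<close>, it suffices to treat functions
  supported in cubes of that size, where this sup bound alone controls the main term with a
  power of \<open>\<Lambda>\<close> to spare. The argument for \<open>k \<ge> 3\<close> works verbatim for \<open>k = 2\<close>.
\<close>

subsection \<open>Trigonometric polynomials in one variable\<close>

text \<open>The obstacle is that the maximal \<ell>^2 hypothesis concerns the error alone; no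
  maximal \<ell>^2 bound for the main term is at hand. The main term therefore enters only through
  the sup H of its kernel, about \<Lambda>^(-s) with s = n/k, against \<Lambda>^(1-s) for the
  average. A sup bound is an \<ell>^1 to \<ell>^\<infinity> bound, and becomes an \<ell>^p to
  \<ell>^p' bound only at the price of counting points, which is why cubes with V about \<Lambda>^s
  points are needed. There the price is V^2 H^p', about \<Lambda>^(2s - s p'), and this is the p'-th
  power of the target times \<Lambda>^(-(p'-2)). Since p < 2 gives p' > 2, the saving beats every
  power of the logarithm. The logarithms lost on the error part, from the level sets and from its
  kernel bound, are repaid by the free exponent in the \<ell>^2 hypothesis. The multiplier bound is
  known only as a bound for a bilinear form on finitely supported sequences. To reach the kernel,
  the form is tested on Fourier coefficients of trigonometric polynomials that approximate a
  continuous cutoff to the arcs.\<close>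

lemma ee_0 [simp]: "ee 0 = 1"
  by (simp add: ee_def)

lemma ee_add: "ee (a + b) = ee a * ee b"
  by (simp add: ee_def distrib_left cis_mult)

lemma norm_ee [simp]: "cmod (ee t) = 1"
  by (simp add: ee_def)

lemma cnj_ee [simp]: "cnj (ee t) = ee (- t)"
  by (simp add: ee_def cis_cnj)

lemma ee_of_int [simp]: "ee (real_of_int m) = 1"
  by (simp add: ee_def cis_multiple_2pi)

lemma ee_mult_nat: "ee (real q * t) = ee t ^ q"
  by (induction q) (simp_all add: ee_add algebra_simps)

lemma ee_sum: "ee (\<Sum>i\<in>A. f i) = (\<Prod>i\<in>A. ee (f i))"
  by (induction A rule: infinite_finite_induct) (simp_all add: ee_add)

lemma continuous_on_ee [continuous_intros]:
  "continuous_on S f \<Longrightarrow> continuous_on S (\<lambda>x. ee (f x))"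
  unfolding ee_def by (intro continuous_intros)

lemma borel_measurable_ee [measurable]: "ee \<in> borel_measurable borel"
  by (intro borel_measurable_continuous_onI continuous_intros)

lemma cmod_ee_diff_1: "cmod (ee t - 1) = 2 * \<bar>sin (pi * t)\<bar>"
proof -
  have "cmod (ee t - 1) ^ 2 = (cos (2 * pi * t) - 1)\<^sup>2 + (sin (2 * pi * t))\<^sup>2"
    by (simp add: ee_def cmod_power2)
  also have "\<dots> = 2 - 2 * cos (2 * pi * t)"
    using sin_cos_squared_add[of "2 * pi * t"] by (simp add: power2_eq_square algebra_simps)
  also have "\<dots> = (2 * \<bar>sin (pi * t)\<bar>)\<^sup>2"
    using cos_double_sin[of "pi * t"] by (simp add: power_mult_distrib algebra_simps)
  finally show ?thesis by (rule power2_eq_imp_eq) auto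
qed

lemma cmod_ee_diff_1_le: "cmod (ee t - 1) \<le> 2 * pi * \<bar>t - real_of_int a\<bar>"
proof -
  have "ee t = ee (t - real_of_int a)"
    using ee_add[of "t - real_of_int a" "real_of_int a"] by simp
  then have "cmod (ee t - 1) = 2 * \<bar>sin (pi * (t - real_of_int a))\<bar>"
    by (simp only: cmod_ee_diff_1)
  also have "\<dots> \<le> 2 * \<bar>pi * (t - real_of_int a)\<bar>"
    using abs_sin_x_le_abs_x[of "pi * (t - real_of_int a)"] by simp
  finally show ?thesis by (simp add: abs_mult)
qed

text \<open>By concavity the sine lies above its chord on [0, pi/2], of slope 2/pi, and pi \<le> 4
  makes that slope at least 1/2.\<close>

lemma sin_ge_half:
  assumes "0 \<le> x" "x \<le> pi / 2" shows "x / 2 \<le> sin x"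
proof -
  have "concave_on {0..pi} sin"
    unfolding concave_on_def
    by (rule f''_ge0_imp_convex[where f' = "\<lambda>x. - cos x" and f'' = sin])
       (auto intro!: derivative_eq_intros sin_ge_zero)
  then have "sin ((1 - 2 * x / pi) *\<^sub>R 0 + (2 * x / pi) *\<^sub>R (pi / 2))
      \<ge> (1 - 2 * x / pi) * sin 0 + (2 * x / pi) * sin (pi / 2)"
    using assms by (intro concave_onD) (auto simp: field_simps)
  then have "2 * x / pi \<le> sin x" by simp
  moreover have "x / 2 \<le> 2 * x / pi"
    using assms mult_right_mono[of pi 4 x] pi_less_4 by (simp add: field_simps)
  ultimately show ?thesis by simp
qed

text \<open>Together with \<open>cmod_ee_diff_1_le\<close> this makes \<open>cmod (ee t - 1)\<close>
  a continuous periodic substitute for the distance from t to the nearest integer; the cutoff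
  \<open>arc_cut\<close> is built from it.\<close>

lemma cmod_ee_diff_1_ge: "2 * \<bar>t - real_of_int (round t)\<bar> \<le> cmod (ee t - 1)"
proof -
  define u where "u = t - real_of_int (round t)"
  have u: "\<bar>u\<bar> \<le> 1 / 2"
    using of_int_round_abs_le[of t] by (simp add: u_def abs_minus_commute)
  have "ee t = ee u"
    using ee_add[of u "real_of_int (round t)"] by (simp add: u_def)
  then have *: "cmod (ee t - 1) = 2 * \<bar>sin (pi * u)\<bar>"
    by (simp only: cmod_ee_diff_1)
  have "pi * \<bar>u\<bar> / 2 \<le> sin (pi * \<bar>u\<bar>)"
    using u by (intro sin_ge_half) auto
  also have "\<dots> \<le> \<bar>sin (pi * u)\<bar>"
    by (cases "u \<ge> 0") auto
  finally have "pi * \<bar>u\<bar> \<le> cmod (ee t - 1)" using * by simp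
  moreover have "2 * \<bar>u\<bar> \<le> pi * \<bar>u\<bar>"
    using pi_ge_two by (intro mult_right_mono) auto
  ultimately show ?thesis by (simp add: u_def)
qed


text \<open>Frequencies are integers, so that the coefficients can later serve as test sequences on
  the lattice.\<close>

definition trig_fun :: "(real \<Rightarrow> complex) \<Rightarrow> bool" where
  "trig_fun t \<longleftrightarrow> (\<exists>J c. finite J \<and> t = (\<lambda>x. \<Sum>j\<in>J. c j * ee (real_of_int j * x)))"

lemma trig_fun_monomial: "trig_fun (\<lambda>x. c * ee (real_of_int j * x))"
  unfolding trig_fun_def by (intro exI[of _ "{j}"] exI[of _ "\<lambda>_. c"]) simp

lemma trig_fun_const: "trig_fun (\<lambda>x. c)"
  using trig_fun_monomial[of c 0] by simp

lemma trig_fun_add: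
  assumes "trig_fun s" "trig_fun t" shows "trig_fun (\<lambda>x. s x + t x)"
proof -
  obtain J c where J: "finite J" and s: "s = (\<lambda>x. \<Sum>j\<in>J. c j * ee (real_of_int j * x))"
    using assms(1) unfolding trig_fun_def by blast
  obtain I d where I: "finite I" and t: "t = (\<lambda>x. \<Sum>j\<in>I. d j * ee (real_of_int j * x))"
    using assms(2) unfolding trig_fun_def by blast
  define b where "b j = (if j \<in> J then c j else 0) + (if j \<in> I then d j else 0)" for j
  have "s x + t x = (\<Sum>j\<in>J \<union> I. b j * ee (real_of_int j * x))" for x
  proof -
    have "s x = (\<Sum>j\<in>J \<union> I. (if j \<in> J then c j else 0) * ee (real_of_int j * x))"
      unfolding s by (rule sum.mono_neutral_cong_left) (use I J in auto)
    moreover have "t x = (\<Sum>j\<in>J \<union> I. (if j \<in> I then d j else 0) * ee (real_of_int j * x))"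
      unfolding t by (rule sum.mono_neutral_cong_left) (use I J in auto)
    ultimately show ?thesis by (simp add: b_def distrib_right sum.distrib)
  qed
  then show ?thesis
    unfolding trig_fun_def using I J by (intro exI[of _ "J \<union> I"] exI[of _ b] conjI ext) auto
qed

lemma trig_fun_sum:
  assumes "finite A" "\<And>i. i \<in> A \<Longrightarrow> trig_fun (f i)" shows "trig_fun (\<lambda>x. \<Sum>i\<in>A. f i x)"
  using assms
proof (induction rule: finite_induct)
  case (insert i A)
  then have "trig_fun (\<lambda>x. f i x + (\<Sum>i\<in>A. f i x))" by (intro trig_fun_add) auto
  then show ?case using insert.hyps by simp
qed (simp add: trig_fun_const)

lemma trig_fun_mult:
  assumes "trig_fun s" "trig_fun t" shows "trig_fun (\<lambda>x. s x * t x)"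
proof -
  obtain J c where J: "finite J" and s: "s = (\<lambda>x. \<Sum>j\<in>J. c j * ee (real_of_int j * x))"
    using assms(1) unfolding trig_fun_def by blast
  obtain I d where I: "finite I" and t: "t = (\<lambda>x. \<Sum>j\<in>I. d j * ee (real_of_int j * x))"
    using assms(2) unfolding trig_fun_def by blast
  have "(\<lambda>x. s x * t x) = (\<lambda>x. \<Sum>j\<in>J. \<Sum>i\<in>I. (c j * d i) * ee (real_of_int (j + i) * x))"
    unfolding s t sum_product by (simp add: ee_add algebra_simps)
  then show ?thesis
    by (simp only:) (intro trig_fun_sum[OF J] trig_fun_sum[OF I] trig_fun_monomial)
qed

text \<open>A real-linear map of the plane is \<open>f z = Re z * f 1 + Im z * f \<i>\<close>, and
  the real and imaginary parts of \<open>ee x\<close> are combinations of \<open>ee x\<close> and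
  \<open>ee (- x)\<close>; closure under sums and products does the rest.\<close>

lemma trig_fun_polynomial:
  assumes "real_polynomial_function g" shows "trig_fun (\<lambda>x. complex_of_real (g (ee x)))"
  using assms
proof induction
  case (linear f)
  interpret bounded_linear f by fact
  have "complex_of_real (f (ee x)) =
      (f 1 / 2 - f \<i> * \<i> / 2) * ee (real_of_int 1 * x) + (f 1 / 2 + f \<i> * \<i> / 2) * ee (real_of_int (- 1) * x)" for x
  proof -
    have "f (ee x) = f (Re (ee x) *\<^sub>R 1 + Im (ee x) *\<^sub>R \<i>)"
      by (rule arg_cong[of _ _ f]) (simp add: complex_eq_iff)
    also have "\<dots> = Re (ee x) * f 1 + Im (ee x) * f \<i>"
      by (simp only: add scale) simp
    finally show ?thesis
      by (simp add: ee_def complex_eq_iff algebra_simps)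
  qed
  then show ?case by (simp only:) (intro trig_fun_add trig_fun_monomial)
qed (simp_all add: trig_fun_const trig_fun_add trig_fun_mult)

text \<open>Stone-Weierstrass on the unit circle, with real polynomials in the two plane
  coordinates. Working on the circle rather than on [0, 1] makes the approximants periodic.\<close>

lemma trig_approx:
  fixes F :: "complex \<Rightarrow> real"
  assumes "continuous_on (sphere 0 1) F" "0 < \<epsilon>"
  obtains t where "trig_fun t" "\<And>x. cmod (t x - F (ee x)) < \<epsilon>"
proof -
  obtain g where g: "real_polynomial_function g" "\<And>x. x \<in> sphere 0 1 \<Longrightarrow> \<bar>F x - g x\<bar> < \<epsilon>"
    using Stone_Weierstrass_real_polynomial_function[OF compact_sphere assms] by blast
  show ?thesis
  proof
    show "trig_fun (\<lambda>x. complex_of_real (g (ee x)))" using g(1) by (rule trig_fun_polynomial)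
    show "cmod (complex_of_real (g (ee x)) - F (ee x)) < \<epsilon>" for x
      using g(2)[of "ee x"] by (simp add: abs_minus_commute flip: of_real_diff)
  qed
qed

lemma ee_has_integral: "((\<lambda>x. ee (real_of_int j * x)) has_integral (if j = 0 then 1 else 0)) {0..1}"
proof (cases "j = 0")
  case True
  then show ?thesis using has_integral_const_real[of "1::complex" 0 1] by simp
next
  case False
  define c where "c = complex_of_real (2 * pi * j) * \<i>"
  have c: "c \<noteq> 0" using False by (simp add: c_def)
  have ee_c: "ee (real_of_int j * x) = exp (c * complex_of_real x)" for x
    by (simp add: ee_def cis_conv_exp c_def mult_ac)
  have "((\<lambda>x. ee (real_of_int j * x)) has_integral
      exp (c * complex_of_real 1) / c - exp (c * complex_of_real 0) / c) {0..1}"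
    unfolding ee_c
  proof (rule fundamental_theorem_of_calculus)
    fix x :: real
    have "((\<lambda>z. exp (c * z) / c) has_field_derivative exp (c * complex_of_real x)) (at (complex_of_real x))"
      using c by (auto intro!: derivative_eq_intros)
    then show "((\<lambda>x. exp (c * complex_of_real x) / c) has_vector_derivative exp (c * complex_of_real x))
        (at x within {0..1})"
      by (rule has_vector_derivative_real_field)
  qed simp
  then show ?thesis using False ee_c[of 1] by simp
qed

lemma trig_parseval:
  assumes "finite J"
  shows "((\<lambda>x. (cmod (\<Sum>j\<in>J. c j * ee (real_of_int j * x)))\<^sup>2) has_integral (\<Sum>j\<in>J. (cmod (c j))\<^sup>2)) {0..1}"
proof -
  have "((\<lambda>x. \<Sum>j\<in>J. \<Sum>i\<in>J. c j * cnj (c i) * ee (real_of_int (j - i) * x)) has_integral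
      (\<Sum>j\<in>J. \<Sum>i\<in>J. c j * cnj (c i) * (if j - i = 0 then 1 else 0))) {0..1}"
    by (intro has_integral_sum assms has_integral_mult_right ee_has_integral)
  moreover have "(\<Sum>j\<in>J. \<Sum>i\<in>J. c j * cnj (c i) * ee (real_of_int (j - i) * x)) =
      complex_of_real ((cmod (\<Sum>j\<in>J. c j * ee (real_of_int j * x)))\<^sup>2)" for x
  proof -
    have "ee (real_of_int (j - i) * x) = ee (real_of_int j * x) * cnj (ee (real_of_int i * x))" for i j
      by (simp add: left_diff_distrib flip: ee_add)
    then show ?thesis
      unfolding complex_norm_square cnj_sum sum_product by (simp add: mult_ac del: cnj_ee)
  qed
  moreover have "(\<Sum>j\<in>J. \<Sum>i\<in>J. c j * cnj (c i) * (if j - i = 0 then 1 else 0)) =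
      complex_of_real (\<Sum>j\<in>J. (cmod (c j))\<^sup>2)"
    using assms by (simp add: if_distrib[of "\<lambda>x. _ * x"] complex_norm_square del: of_real_power cong: if_cong)
  ultimately have "((\<lambda>x. complex_of_real ((cmod (\<Sum>j\<in>J. c j * ee (real_of_int j * x)))\<^sup>2)) has_integral
      complex_of_real (\<Sum>j\<in>J. (cmod (c j))\<^sup>2)) {0..1}"
    by simp
  from has_integral_linear[OF this bounded_linear_Re] show ?thesis by (simp add: o_def)
qed

subsection \<open>Kernels of bounded multipliers with small support\<close>

text \<open>A continuous stand-in for the indicator of the arcs around fractions with denominator q
  \<le> Q: the q-th summand is at least 1 where |z^q - 1| \<le> \<delta> and vanishes from 2
  \<delta> on. Continuity makes it accessible to trigonometric approximation, the argument on the
  circle builds in periodicity, and \<open>min 1\<close> caps overlapping arcs.\<close>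

definition arc_cut :: "nat \<Rightarrow> real \<Rightarrow> complex \<Rightarrow> real" where
  "arc_cut Q \<delta> z = min 1 (\<Sum>q\<in>{1..Q}. max 0 (2 - cmod (z ^ q - 1) / \<delta>))"

lemma continuous_on_arc_cut: "\<delta> > 0 \<Longrightarrow> continuous_on S (arc_cut Q \<delta>)"
  unfolding arc_cut_def by (intro continuous_intros) auto

lemma arc_cut_nonneg: "0 \<le> arc_cut Q \<delta> z"
  unfolding arc_cut_def by (auto intro!: sum_nonneg)

lemma arc_cut_le_1: "arc_cut Q \<delta> z \<le> 1"
  unfolding arc_cut_def by auto

lemma arc_cut_eq_1:
  assumes "\<delta> > 0" "1 \<le> q" "q \<le> Q" "2 * pi * \<bar>real q * x - real_of_int a\<bar> \<le> \<delta>"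
  shows "arc_cut Q \<delta> (ee x) = 1"
proof -
  have "cmod (ee x ^ q - 1) \<le> \<delta>"
    using cmod_ee_diff_1_le[of "real q * x" a] assms(4) by (simp add: ee_mult_nat)
  then have "1 \<le> max 0 (2 - cmod (ee x ^ q - 1) / \<delta>)"
    using assms(1) by (simp add: field_simps le_max_iff_disj)
  also have "\<dots> \<le> (\<Sum>q\<in>{1..Q}. max 0 (2 - cmod (ee x ^ q - 1) / \<delta>))"
    by (rule member_le_sum) (use assms in auto)
  finally show ?thesis unfolding arc_cut_def by simp
qed

lemma integral_indicat_Icc:
  assumes "u \<le> v"
  shows "(indicat_real {u..v}) integrable_on {0..1}" "integral {0..1} (indicat_real {u..v}) \<le> v - u"
proof -
  have lm: "{u..v} \<inter> {0..1} \<in> lmeasurable"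
    by (simp add: fmeasurable.Int)
  show "(indicat_real {u..v}) integrable_on {0..1}"
    using lm by (simp add: integrable_on_indicator)
  have "integral {0..1} (indicat_real {u..v}) = measure lebesgue ({u..v} \<inter> {0..1})"
    using lm by (rule integral_indicator)
  also have "\<dots> \<le> measure lebesgue {u..v}"
    by (rule measure_mono_fmeasurable) auto
  finally show "integral {0..1} (indicat_real {u..v}) \<le> v - u" using assms by simp
qed

lemma integral_arc_cut:
  assumes "\<delta> > 0"
  shows "integral {0..1} (\<lambda>x. arc_cut Q \<delta> (ee x)) \<le> 8 * real Q * \<delta>"
proof -
  \<comment> \<open>By \<open>cmod_ee_diff_1_ge\<close> the q-th summand is nonzero only if q x is
    within \<delta> of an integer a, and x in [0, 1] leaves the q + 1 values 0, ..., q for a. So it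
    lives on intervals of length 2 \<delta>/q and has height at most 2.\<close>
  define u where "u q a = (real a - \<delta>) / real q" for q a :: nat
  define v where "v q a = (real a + \<delta>) / real q" for q a :: nat
  have uv: "u q a \<le> v q a" for q a
    using assms by (simp add: u_def v_def divide_right_mono)
  have pw: "arc_cut Q \<delta> (ee x) \<le> (\<Sum>q\<in>{1..Q}. \<Sum>a\<in>{0..q}. 2 * indicat_real {u q a..v q a} x)"
    if x: "x \<in> {0..1}" for x
  proof -
    have "max 0 (2 - cmod (ee x ^ q - 1) / \<delta>) \<le> (\<Sum>a\<in>{0..q}. 2 * indicat_real {u q a..v q a} x)"
      if q: "q \<in> {1..Q}" for q
    proof (cases "cmod (ee x ^ q - 1) < 2 * \<delta>")
      case False
      then have "max 0 (2 - cmod (ee x ^ q - 1) / \<delta>) = 0"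
        using assms by (simp add: field_simps)
      then show ?thesis by (auto intro!: sum_nonneg)
    next
      case True
      define a where "a = nat (round (real q * x))"
      have qx: "0 \<le> real q * x" "real q * x \<le> real q"
        using x by (auto intro: mult_left_le)
      have "round (real q * x) \<le> round (real q)"
        using qx(2) by (rule round_mono)
      moreover have "round (0::real) \<le> round (real q * x)"
        using qx(1) by (rule round_mono)
      ultimately have a: "real a = real_of_int (round (real q * x))" "a \<le> q"
        by (auto simp: a_def)
      have "2 * \<bar>real q * x - real a\<bar> < 2 * \<delta>"
        using cmod_ee_diff_1_ge[of "real q * x"] True by (simp add: ee_mult_nat a(1))
      then have "x \<in> {u q a..v q a}"
        using q unfolding u_def v_def by (auto simp: field_simps abs_less_iff)
      then have "2 = 2 * indicat_real {u q a..v q a} x" by simp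
      also have "\<dots> \<le> (\<Sum>a\<in>{0..q}. 2 * indicat_real {u q a..v q a} x)"
        by (rule member_le_sum) (use a in auto)
      finally have "2 \<le> (\<Sum>a\<in>{0..q}. 2 * indicat_real {u q a..v q a} x)" .
      moreover have "max 0 (2 - cmod (ee x ^ q - 1) / \<delta>) \<le> 2" using assms by simp
      ultimately show ?thesis by linarith
    qed
    then have "(\<Sum>q\<in>{1..Q}. max 0 (2 - cmod (ee x ^ q - 1) / \<delta>)) \<le>
        (\<Sum>q\<in>{1..Q}. \<Sum>a\<in>{0..q}. 2 * indicat_real {u q a..v q a} x)"
      by (rule sum_mono)
    then show ?thesis unfolding arc_cut_def by linarith
  qed
  have int: "(\<lambda>x. \<Sum>q\<in>{1..Q}. \<Sum>a\<in>{0..q}. 2 * indicat_real {u q a..v q a} x) integrable_on {0..1}"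
    by (intro integrable_sum integrable_on_mult_right integral_indicat_Icc uv) auto
  have "integral {0..1} (\<lambda>x. arc_cut Q \<delta> (ee x)) \<le>
      integral {0..1} (\<lambda>x. \<Sum>q\<in>{1..Q}. \<Sum>a\<in>{0..q}. 2 * indicat_real {u q a..v q a} x)"
  proof (rule integral_le)
    have "continuous_on {0..1} (\<lambda>x. arc_cut Q \<delta> (ee x))"
      using continuous_on_compose[OF continuous_on_ee[OF continuous_on_id] continuous_on_arc_cut[OF assms]]
      by (simp add: o_def)
    then show "(\<lambda>x. arc_cut Q \<delta> (ee x)) integrable_on {0..1}"
      by (rule integrable_continuous_real)
  qed (use int pw in auto)
  also have "\<dots> = (\<Sum>q\<in>{1..Q}. \<Sum>a\<in>{0..q}. 2 * integral {0..1} (indicat_real {u q a..v q a}))"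
    by (simp add: Henstock_Kurzweil_Integration.integral_sum integrable_sum integrable_on_mult_right
          integral_indicat_Icc uv del: sum_mult_indicator sum_indicator_eq_card)
  also have "\<dots> \<le> (\<Sum>q\<in>{1..Q}. \<Sum>a\<in>{0..q}. 2 * (v q a - u q a))"
    by (intro sum_mono mult_left_mono integral_indicat_Icc uv) auto
  also have "\<dots> = (\<Sum>q\<in>{1..Q}. real (q + 1) * (4 * \<delta> / real q))"
    by (simp add: u_def v_def add_divide_distrib diff_divide_distrib)
  \<comment> \<open>As q + 1 \<le> 2 q, the number of intervals is cancelled by their length, and
    each q costs 8 \<delta>.\<close>
  also have "\<dots> \<le> (\<Sum>q\<in>{1..Q}. 8 * \<delta>)"
  proof (rule sum_mono)
    fix q assume "q \<in> {1..Q}"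
    then have "real (q + 1) \<le> 2 * real q" "0 < real q" by auto
    then show "real (q + 1) * (4 * \<delta> / real q) \<le> 8 * \<delta>"
      using assms by (simp add: field_simps)
  qed
  finally show ?thesis by simp
qed

lemma integrable_mult_bounded:
  fixes f g :: "'a \<Rightarrow> complex"
  assumes "integrable M f" "g \<in> borel_measurable M" "\<And>x. cmod (g x) \<le> B"
  shows "integrable M (\<lambda>x. f x * g x)"
proof (rule Bochner_Integration.integrable_bound)
  show "integrable M (\<lambda>x. complex_of_real B * f x)" using assms(1) by simp
  show "(\<lambda>x. f x * g x) \<in> borel_measurable M"
    by (rule borel_measurable_times[OF borel_measurable_integrable[OF assms(1)] assms(2)])
  show "AE x in M. norm (f x * g x) \<le> norm (complex_of_real B * f x)"
    using assms(3) by (intro AE_I2) (auto simp: norm_mult mult.commute[of "cmod (f _)"] intro!: mult_right_mono order_trans[OF assms(3)])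
qed

lemma borel_measurable_character:
  "(\<lambda>\<xi>. ee (\<Sum>i<n. r i * \<xi> i)) \<in> borel_measurable (\<Pi>\<^sub>M i\<in>{..<n}. lborel)"
proof -
  have "(\<lambda>\<xi>. \<Sum>i<n. r i * \<xi> i) \<in> borel_measurable (\<Pi>\<^sub>M i\<in>{..<n}. lborel)"
    by measurable
  then show ?thesis by (rule measurable_compose[OF _ borel_measurable_ee])
qed

lemma trig_fun_measurable: "trig_fun t \<Longrightarrow> t \<in> borel_measurable borel"
  unfolding trig_fun_def by (auto intro!: borel_measurable_continuous_onI continuous_intros)

text \<open>Testing the bilinear form with \<open>a y = \<Prod>\<^sub>i c (y i)\<close> replaces the kernel by an average of the
  multiplier against the square of a trigonometric polynomial.\<close>

lemma kernel_trig_test: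
  fixes f :: "(nat \<Rightarrow> real) \<Rightarrow> complex" and n :: nat and x0 :: "nat \<Rightarrow> int" and c :: real
  defines "M \<equiv> \<Pi>\<^sub>M i\<in>{..<n}. lborel"
  assumes f: "integrable M f"
    and K: "\<And>x. K x = (LINT \<xi>|M. f \<xi> * ee (- (\<Sum>i<n. real_of_int (x i) * \<xi> i)))"
    and bil: "\<And>F a. finite F \<Longrightarrow> F \<subseteq> int_vecs n \<Longrightarrow>
      cmod (\<Sum>l\<in>F. \<Sum>y\<in>F. cnj (a l) * a y * K (vec_diff n (\<lambda>i\<in>{..<n}. l i + x0 i) y))
        \<le> c * (\<Sum>y\<in>F. (cmod (a y))\<^sup>2)"
    and t: "trig_fun t"
  shows "cmod (LINT \<xi>|M. f \<xi> * (complex_of_real (\<Prod>i<n. (cmod (t (\<xi> i)))\<^sup>2)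
                 * ee (- (\<Sum>i<n. real_of_int (x0 i) * \<xi> i))))
           \<le> c * integral {0..1} (\<lambda>x. (cmod (t x))\<^sup>2) ^ n"
proof -
  obtain J d where J: "finite J" and td: "t = (\<lambda>x. \<Sum>j\<in>J. d j * ee (real_of_int j * x))"
    using t unfolding trig_fun_def by blast
  \<comment> \<open>The product of t over the coordinates is a trigonometric polynomial with
    frequencies in the box \<open>F\<close> and coefficients \<open>a\<close>, which form the test
    sequence.\<close>
  define F where "F = {..<n} \<rightarrow>\<^sub>E J"
  define a where "a y = (\<Prod>i<n. d (y i))" for y :: "nat \<Rightarrow> int"
  have F: "finite F" "F \<subseteq> int_vecs n"
    using J by (auto simp: F_def int_vecs_def intro!: finite_PiE)
  have prod_t: "(\<Prod>i<n. t (\<xi> i)) = (\<Sum>y\<in>F. a y * ee (\<Sum>i<n. real_of_int (y i) * \<xi> i))" for \<xi> :: "nat \<Rightarrow> real"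
    unfolding td F_def a_def by (subst prod_sum_PiE) (use J in \<open>auto simp: ee_sum prod.distrib\<close>)
  have integrand: "f \<xi> * (complex_of_real (\<Prod>i<n. (cmod (t (\<xi> i)))\<^sup>2) * ee (- (\<Sum>i<n. real_of_int (x0 i) * \<xi> i)))
      = (\<Sum>l\<in>F. \<Sum>y\<in>F. cnj (a l) * a y *
          (f \<xi> * ee (- (\<Sum>i<n. real_of_int (vec_diff n (\<lambda>i\<in>{..<n}. l i + x0 i) y i) * \<xi> i))))"
    for \<xi> :: "nat \<Rightarrow> real"
  proof -
    have "complex_of_real (\<Prod>i<n. (cmod (t (\<xi> i)))\<^sup>2) = cnj (\<Prod>i<n. t (\<xi> i)) * (\<Prod>i<n. t (\<xi> i))"
      by (simp add: complex_norm_square prod.distrib mult.commute del: of_real_power)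
    also have "\<dots> = (\<Sum>l\<in>F. \<Sum>y\<in>F. cnj (a l) * a y *
        (ee (- (\<Sum>i<n. real_of_int (l i) * \<xi> i)) * ee (\<Sum>i<n. real_of_int (y i) * \<xi> i)))"
      unfolding prod_t cnj_sum sum_product by (simp add: mult_ac)
    finally have *: "complex_of_real (\<Prod>i<n. (cmod (t (\<xi> i)))\<^sup>2) = \<dots>" .
    \<comment> \<open>The character of frequency l + x0 - y splits into one in l, one in y and a
      fixed one in x0. The shift by \<open>x0\<close> in the bilinear form is there to produce the
      last factor.\<close>
    have "ee (- (\<Sum>i<n. real_of_int (vec_diff n (\<lambda>i\<in>{..<n}. l i + x0 i) y i) * \<xi> i)) =
       ee (- (\<Sum>i<n. real_of_int (l i) * \<xi> i)) * ee (\<Sum>i<n. real_of_int (y i) * \<xi> i)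
        * ee (- (\<Sum>i<n. real_of_int (x0 i) * \<xi> i))" for l y
      by (simp add: vec_diff_def algebra_simps sum.distrib sum_subtractf flip: ee_add)
    then show ?thesis unfolding * by (simp add: sum_distrib_left sum_distrib_right mult_ac)
  qed
  have int: "integrable M (\<lambda>\<xi>. f \<xi> * ee (- (\<Sum>i<n. real_of_int (x i) * \<xi> i)))" for x
    using f
  proof (rule integrable_mult_bounded[where B = 1])
    show "(\<lambda>\<xi>. ee (- (\<Sum>i<n. real_of_int (x i) * \<xi> i))) \<in> borel_measurable M"
      using borel_measurable_character[where r = "\<lambda>i. - real_of_int (x i)"] by (simp add: M_def sum_negf)
  qed simp
  have "(LINT \<xi>|M. f \<xi> * (complex_of_real (\<Prod>i<n. (cmod (t (\<xi> i)))\<^sup>2)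
        * ee (- (\<Sum>i<n. real_of_int (x0 i) * \<xi> i))))
      = (\<Sum>l\<in>F. \<Sum>y\<in>F. cnj (a l) * a y * K (vec_diff n (\<lambda>i\<in>{..<n}. l i + x0 i) y))"
    unfolding integrand K
    by (simp only: Bochner_Integration.integral_sum Bochner_Integration.integrable_sum
          integrable_mult_right integral_mult_right_zero int)
  then have "cmod (LINT \<xi>|M. f \<xi> * (complex_of_real (\<Prod>i<n. (cmod (t (\<xi> i)))\<^sup>2)
        * ee (- (\<Sum>i<n. real_of_int (x0 i) * \<xi> i)))) \<le> c * (\<Sum>y\<in>F. (cmod (a y))\<^sup>2)"
    using bil[OF F] by simp
  also have "(\<Sum>y\<in>F. (cmod (a y))\<^sup>2) = (\<Prod>i<n. \<Sum>j\<in>J. (cmod (d j))\<^sup>2)"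
  proof -
    have "(cmod (a y))\<^sup>2 = (\<Prod>i<n. (cmod (d (y i)))\<^sup>2)" for y
      unfolding a_def by (simp only: prod_norm[symmetric] prod_power_distrib)
    then show ?thesis unfolding F_def by (subst prod_sum_PiE) (use J in auto)
  qed
  also have "\<dots> = integral {0..1} (\<lambda>x. (cmod (t x))\<^sup>2) ^ n"
    using integral_unique[OF trig_parseval[OF J, of d]] by (simp add: td)
  finally show ?thesis .
qed

text \<open>The familiar bound by the sup of the multiplier times the measure of its support, with
  the sup replaced by the bilinear bound c. Test with trigonometric polynomials tending uniformly to
  F: as F is 1 in every coordinate on the support of f, the weight disappears in the limit, while
  the right side stays near c times a power of the integral of F.\<close>

lemma bounded_multiplier_kernel:
  fixes f :: "(nat \<Rightarrow> real) \<Rightarrow> complex" and n :: nat and x0 :: "nat \<Rightarrow> int"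
    and c :: real and F :: "complex \<Rightarrow> real"
  defines "M \<equiv> \<Pi>\<^sub>M i\<in>{..<n}. lborel"
  assumes K: "\<And>x. K x = (LINT \<xi>|M. f \<xi> * ee (- (\<Sum>i<n. real_of_int (x i) * \<xi> i)))"
    and bil: "\<And>A a. finite A \<Longrightarrow> A \<subseteq> int_vecs n \<Longrightarrow>
      cmod (\<Sum>l\<in>A. \<Sum>y\<in>A. cnj (a l) * a y * K (vec_diff n (\<lambda>i\<in>{..<n}. l i + x0 i) y))
        \<le> c * (\<Sum>y\<in>A. (cmod (a y))\<^sup>2)"
    and c: "0 \<le> c"
    and F: "continuous_on (sphere 0 1) F" "\<And>z. 0 \<le> F z" "\<And>z. F z \<le> 1"
    and supp: "\<And>\<xi> i. f \<xi> \<noteq> 0 \<Longrightarrow> i < n \<Longrightarrow> F (ee (\<xi> i)) = 1"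
  shows "cmod (K x0) \<le> c * integral {0..1} (\<lambda>x. F (ee x)) ^ n"
proof (cases "integrable M f")
  case False
  have "\<not> integrable M (\<lambda>\<xi>. f \<xi> * ee (- (\<Sum>i<n. real_of_int (x0 i) * \<xi> i)))"
  proof
    assume "integrable M (\<lambda>\<xi>. f \<xi> * ee (- (\<Sum>i<n. real_of_int (x0 i) * \<xi> i)))"
    then have "integrable M (\<lambda>\<xi>. f \<xi> * ee (- (\<Sum>i<n. real_of_int (x0 i) * \<xi> i)) * ee (\<Sum>i<n. real_of_int (x0 i) * \<xi> i))"
      unfolding M_def by (rule integrable_mult_bounded[where B = 1, OF _ borel_measurable_character]) simp
    then show False using False by (simp add: mult.assoc flip: ee_add)
  qed
  \<comment> \<open>The Bochner integral of a non-integrable function has the default value 0, so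
    this case is trivial and the regularity of the multiplier never has to be examined.\<close>
  then have "K x0 = 0" unfolding K by (rule not_integrable_integral_eq)
  moreover have "0 \<le> integral {0..1} (\<lambda>x. F (ee x))"
    using F(2) by (intro Henstock_Kurzweil_Integration.integral_nonneg integrable_continuous_real
      continuous_on_compose2[OF F(1)]) (auto intro!: continuous_intros)
  ultimately show ?thesis using c by simp
next
  case True
  define I where "I = integral {0..1} (\<lambda>x. F (ee x))"
  define \<epsilon> where "\<epsilon> j = inverse (real (Suc j))" for j
  have \<epsilon>: "0 < \<epsilon> j" "\<epsilon> j \<le> 1" for j by (auto simp: \<epsilon>_def field_simps)
  have "\<exists>t. trig_fun t \<and> (\<forall>x. cmod (t x - F (ee x)) < \<epsilon> j)" for j
    using trig_approx[OF F(1) \<epsilon>(1)[of j]] by metis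
  then obtain t where t: "\<And>j. trig_fun (t j)" "\<And>j x. cmod (t j x - F (ee x)) < \<epsilon> j"
    by metis
  have t_le: "cmod (t j x) \<le> F (ee x) + \<epsilon> j" for j x
    using norm_triangle_sub[of "t j x" "complex_of_real (F (ee x))"] t(2)[of j x] F(2)[of "ee x"] by simp
  have t_le2: "cmod (t j x) \<le> 2" for j x
    using t_le[of j x] F(3)[of "ee x"] \<epsilon>(2)[of j] by simp
  have contF: "continuous_on {0..1} (\<lambda>x. F (ee x))"
    by (rule continuous_on_compose2[OF F(1)]) (auto intro!: continuous_intros)
  have t_int: "(\<lambda>x. (cmod (t j x))\<^sup>2) integrable_on {0..1}" for j
    using t(1)[of j] unfolding trig_fun_def by (auto intro: has_integral_integrable[OF trig_parseval])
  have int_t: "integral {0..1} (\<lambda>x. (cmod (t j x))\<^sup>2) \<le> I + 3 * \<epsilon> j" for j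
  proof -
    have "integral {0..1} (\<lambda>x. (cmod (t j x))\<^sup>2) \<le> integral {0..1} (\<lambda>x. F (ee x) + 3 * \<epsilon> j)"
    proof (rule integral_le)
      show "(\<lambda>x. (cmod (t j x))\<^sup>2) integrable_on {0..1}" by (rule t_int)
      show "(\<lambda>x. F (ee x) + 3 * \<epsilon> j) integrable_on {0..1}"
        by (intro integrable_continuous_real continuous_intros contF)
      show "(cmod (t j x))\<^sup>2 \<le> F (ee x) + 3 * \<epsilon> j" for x
      proof -
        have "(cmod (t j x))\<^sup>2 \<le> (F (ee x) + \<epsilon> j)\<^sup>2"
          by (rule power_mono) (auto simp: t_le)
        also have "\<dots> = F (ee x) * F (ee x) + 2 * (F (ee x) * \<epsilon> j) + \<epsilon> j * \<epsilon> j"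
          by (simp add: power2_eq_square algebra_simps)
        \<comment> \<open>F and \<open>\<epsilon> j\<close> lie in [0, 1], so their squares are at
          most themselves.\<close>
        also have "\<dots> \<le> F (ee x) * 1 + 2 * (1 * \<epsilon> j) + 1 * \<epsilon> j"
          using F(2,3) \<epsilon>[of j] by (intro add_mono mult_left_mono mult_right_mono) auto
        finally show ?thesis by simp
      qed
    qed
    also have "\<dots> = I + 3 * \<epsilon> j"
      unfolding I_def by (subst Henstock_Kurzweil_Integration.integral_add)
        (auto intro!: integrable_continuous_real contF)
    finally show ?thesis .
  qed
  define g where "g j \<xi> = f \<xi> * (complex_of_real (\<Prod>i<n. (cmod (t j (\<xi> i)))\<^sup>2)
                 * ee (- (\<Sum>i<n. real_of_int (x0 i) * \<xi> i)))" for j \<xi>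
  have g_le: "cmod (LINT \<xi>|M. g j \<xi>) \<le> c * (I + 3 * \<epsilon> j) ^ n" for j
  proof -
    have "cmod (LINT \<xi>|M. g j \<xi>) \<le> c * integral {0..1} (\<lambda>x. (cmod (t j x))\<^sup>2) ^ n"
      unfolding g_def M_def
      by (rule kernel_trig_test[OF True[unfolded M_def] K[unfolded M_def] bil t(1)])
    also have "\<dots> \<le> c * (I + 3 * \<epsilon> j) ^ n"
      by (intro mult_left_mono power_mono int_t c Henstock_Kurzweil_Integration.integral_nonneg t_int) auto
    finally show ?thesis .
  qed
  have \<epsilon>_lim: "\<epsilon> \<longlonglongrightarrow> 0" unfolding \<epsilon>_def by (rule LIMSEQ_inverse_real_of_nat)
  have t_lim: "(\<lambda>j. t j x) \<longlonglongrightarrow> complex_of_real (F (ee x))" for x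
  proof (rule LIM_zero_cancel, rule tendsto_norm_zero_cancel, rule tendsto_sandwich[OF _ _ tendsto_const \<epsilon>_lim])
    show "\<forall>\<^sub>F j in sequentially. norm (t j x - complex_of_real (F (ee x))) \<le> \<epsilon> j"
      using t(2) by (auto intro!: always_eventually less_imp_le)
  qed auto
  have meas_ch: "(\<lambda>\<xi>. ee (- (\<Sum>i<n. real_of_int (x0 i) * \<xi> i))) \<in> borel_measurable M"
    using borel_measurable_character[where r = "\<lambda>i. - real_of_int (x0 i)"] by (simp add: M_def sum_negf)
  have meas_f: "f \<in> borel_measurable M" using True by (rule borel_measurable_integrable)
  have "(\<lambda>j. LINT \<xi>|M. g j \<xi>) \<longlonglongrightarrow> (LINT \<xi>|M. f \<xi> * ee (- (\<Sum>i<n. real_of_int (x0 i) * \<xi> i)))"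
  \<comment> \<open>The factor 4 ^ n comes from \<open>t_le2\<close>: each of the n squared factors
    is at most 4.\<close>
  proof (rule integral_dominated_convergence[where w = "\<lambda>\<xi>. 4 ^ n * cmod (f \<xi>)"])
    show "(\<lambda>\<xi>. f \<xi> * ee (- (\<Sum>i<n. real_of_int (x0 i) * \<xi> i))) \<in> borel_measurable M"
      by (rule borel_measurable_times[OF meas_f meas_ch])
    have "(\<lambda>\<xi>. complex_of_real (\<Prod>i<n. (cmod (t j (\<xi> i)))\<^sup>2)) \<in> borel_measurable M" for j
    proof -
      have "(\<lambda>\<xi>. t j (\<xi> i)) \<in> borel_measurable M" if "i < n" for i
      proof (rule measurable_compose[OF _ trig_fun_measurable[OF t(1)]])
        have "(\<lambda>\<xi>. \<xi> i) \<in> measurable M lborel"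
          unfolding M_def using that by (intro measurable_component_singleton) simp
        then show "(\<lambda>\<xi>. \<xi> i) \<in> borel_measurable M" by simp
      qed
      then have "(\<lambda>\<xi>. \<Prod>i<n. (cmod (t j (\<xi> i)))\<^sup>2) \<in> borel_measurable M"
        by - (rule borel_measurable_prod, rule borel_measurable_power, rule measurable_compose[OF _ borel_measurable_norm], auto)
      then show ?thesis by measurable
    qed
    then show "g j \<in> borel_measurable M" for j
      unfolding g_def by (intro borel_measurable_times meas_f meas_ch)
    show "integrable M (\<lambda>\<xi>. 4 ^ n * cmod (f \<xi>))" using True by simp
    show "AE \<xi> in M. (\<lambda>j. g j \<xi>) \<longlonglongrightarrow> f \<xi> * ee (- (\<Sum>i<n. real_of_int (x0 i) * \<xi> i))"
    proof (rule AE_I2)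
      fix \<xi>
      show "(\<lambda>j. g j \<xi>) \<longlonglongrightarrow> f \<xi> * ee (- (\<Sum>i<n. real_of_int (x0 i) * \<xi> i))"
      proof (cases "f \<xi> = 0")
        case False
        have "(\<lambda>j. g j \<xi>) \<longlonglongrightarrow> f \<xi> * (complex_of_real (\<Prod>i<n. (cmod (complex_of_real (F (ee (\<xi> i)))))\<^sup>2)
                 * ee (- (\<Sum>i<n. real_of_int (x0 i) * \<xi> i)))"
          unfolding g_def by (intro tendsto_intros t_lim)
        \<comment> \<open>All limiting weights equal 1 because \<xi> lies in the support of
          f.\<close>
        then show ?thesis using supp[OF False] by simp
      qed (simp add: g_def)
    qed
    show "AE \<xi> in M. norm (g j \<xi>) \<le> 4 ^ n * cmod (f \<xi>)" for j
    proof (rule AE_I2)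
      fix \<xi>
      have "(\<Prod>i<n. (cmod (t j (\<xi> i)))\<^sup>2) \<le> (\<Prod>i<n. 2\<^sup>2)"
        by (intro prod_mono conjI power_mono t_le2) auto
      then show "norm (g j \<xi>) \<le> 4 ^ n * cmod (f \<xi>)"
        unfolding g_def
        by (simp add: norm_mult abs_prod mult.commute mult_left_mono del: of_real_prod of_real_power)
    qed
  qed
  then have "(\<lambda>j. cmod (LINT \<xi>|M. g j \<xi>)) \<longlonglongrightarrow> cmod (K x0)"
    unfolding K by (rule tendsto_norm)
  moreover have "(\<lambda>j. c * (I + 3 * \<epsilon> j) ^ n) \<longlonglongrightarrow> c * (I + 3 * 0) ^ n"
    by (intro tendsto_intros \<epsilon>_lim)
  ultimately have "cmod (K x0) \<le> c * (I + 3 * 0) ^ n"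
    by (rule LIMSEQ_le) (use g_le in auto)
  then show ?thesis by (simp add: I_def)
qed

subsection \<open>Prime averages and the main term kernel\<close>

lemma vec_diff_in [simp]: "vec_diff n x y \<in> int_vecs n"
  by (simp add: vec_diff_def int_vecs_def)

lemma vec_diff_vec_diff: "y \<in> int_vecs n \<Longrightarrow> vec_diff n l (vec_diff n l y) = y"
  by (auto simp: vec_diff_def int_vecs_def PiE_def extensional_def)

lemma inj_on_vec_diff: "A \<subseteq> int_vecs n \<Longrightarrow> inj_on (vec_diff n l) A"
  by (rule inj_on_inverseI[of _ "vec_diff n l"]) (auto simp: vec_diff_vec_diff)

lemma inj_on_vec_diff_left: "A \<subseteq> int_vecs n \<Longrightarrow> inj_on (\<lambda>l. vec_diff n (\<lambda>i\<in>{..<n}. l i + x i) y) A"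
  by (rule inj_on_inverseI[of _ "\<lambda>u. \<lambda>i\<in>{..<n}. u i - x i + y i"])
     (auto simp: vec_diff_def int_vecs_def PiE_def extensional_def subset_iff fun_eq_iff)

lemma inj_on_vec_add: "A \<subseteq> int_vecs n \<Longrightarrow> inj_on (\<lambda>l. \<lambda>i\<in>{..<n}. l i + x i) A"
  by (rule inj_on_inverseI[of _ "\<lambda>u. \<lambda>i\<in>{..<n}. u i - x i"])
     (auto simp: int_vecs_def PiE_def extensional_def subset_iff fun_eq_iff)

lemma convolve_finite_support:
  assumes "finite Y" "Y \<subseteq> int_vecs n" "\<And>y. y \<in> int_vecs n - Y \<Longrightarrow> h y = 0"
  shows "convolve n K h l = (\<Sum>y\<in>Y. K (vec_diff n l y) * h y)"
proof -
  have "convolve n K h l = (\<Sum>\<^sub>\<infinity>x\<in>vec_diff n l ` Y. K x * h (vec_diff n l x))"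
    unfolding convolve_def
  proof (rule infsum_cong_neutral)
    fix x assume x: "x \<in> int_vecs n - vec_diff n l ` Y"
    have "vec_diff n l x \<notin> Y"
    proof
      assume "vec_diff n l x \<in> Y"
      then have "vec_diff n l (vec_diff n l x) \<in> vec_diff n l ` Y" by (rule imageI)
      then show False using x by (simp add: vec_diff_vec_diff)
    qed
    then show "K x * h (vec_diff n l x) = 0" using assms(3) by simp
  qed auto
  also have "\<dots> = (\<Sum>y\<in>Y. K (vec_diff n l y) * h (vec_diff n l (vec_diff n l y)))"
    using assms(1,2) by (simp add: sum.reindex inj_on_vec_diff)
  also have "\<dots> = (\<Sum>y\<in>Y. K (vec_diff n l y) * h y)"
    using assms(2) by (intro sum.cong) (auto simp: vec_diff_vec_diff)
  finally show ?thesis .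
qed

lemma prime_vecs_coord:
  assumes "k \<ge> 1" "x \<in> prime_vecs n k lam" "i < n"
  shows "2 \<le> x i" "x i ^ k \<le> int lam" "x i \<le> int lam"
proof -
  have pr: "\<And>j. j < n \<Longrightarrow> 2 \<le> x j" using assms(2) by (auto simp: prime_vecs_def intro: prime_ge_2_int)
  then show "2 \<le> x i" using assms(3) .
  have "x i ^ k \<le> (\<Sum>i<n. x i ^ k)"
    by (rule member_le_sum) (use assms(3) in \<open>auto intro!: zero_le_power order_trans[OF _ pr]\<close>)
  then show *: "x i ^ k \<le> int lam" using assms(2) by (simp add: prime_vecs_def)
  have "x i ^ 1 \<le> x i ^ k"
    using assms(1) pr[OF assms(3)] by (intro power_increasing) auto
  then show "x i \<le> int lam" using * by simp
qed

lemma finite_prime_vecs: assumes "k \<ge> 1" shows "finite (prime_vecs n k lam)"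
proof (rule finite_subset)
  show "prime_vecs n k lam \<subseteq> {..<n} \<rightarrow>\<^sub>E {0..int lam}"
  proof
    fix x assume x: "x \<in> prime_vecs n k lam"
    then have "x \<in> int_vecs n" by (simp add: prime_vecs_def)
    moreover have "x i \<in> {0..int lam}" if "i < n" for i
      using prime_vecs_coord[OF assms x that] by simp
    ultimately show "x \<in> {..<n} \<rightarrow>\<^sub>E {0..int lam}" by (auto simp: int_vecs_def PiE_iff)
  qed
  show "finite ({..<n} \<rightarrow>\<^sub>E {0..int lam})" by (intro finite_PiE) auto
qed

lemma log_weight_nonneg: "k \<ge> 1 \<Longrightarrow> x \<in> prime_vecs n k lam \<Longrightarrow> 0 \<le> log_weight n x"
  unfolding log_weight_def
  by (intro prod_nonneg ballI ln_ge_zero) (use prime_vecs_coord(1) in force)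

lemma cmod_prime_kernel:
  assumes "k \<ge> 1" "prime_count n k lam > 0"
  shows "cmod (prime_kernel n k lam x) =
    (if x \<in> prime_vecs n k lam then log_weight n x / prime_count n k lam else 0)"
  using assms log_weight_nonneg[OF assms(1), of x n lam] by (simp add: prime_kernel_def norm_divide)

text \<open>The kernel carries probability weights on \<open>prime_vecs\<close>; applied to rows and
  columns this supplies the premises of Schur's test.\<close>

lemma sum_prime_kernel_le_1:
  assumes "k \<ge> 1" "prime_count n k lam > 0" "finite X"
  shows "(\<Sum>x\<in>X. cmod (prime_kernel n k lam x)) \<le> 1"
proof -
  have "(\<Sum>x\<in>X. cmod (prime_kernel n k lam x)) \<le> (\<Sum>x\<in>X \<union> prime_vecs n k lam. cmod (prime_kernel n k lam x))"
    by (rule sum_mono2) (use assms finite_prime_vecs in auto)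
  also have "\<dots> = (\<Sum>x\<in>prime_vecs n k lam. cmod (prime_kernel n k lam x))"
    by (rule sum.mono_neutral_right) (use assms finite_prime_vecs in \<open>auto simp: prime_kernel_def\<close>)
  also have "\<dots> = 1"
    using assms by (simp add: cmod_prime_kernel prime_count_def flip: sum_divide_distrib)
  finally show ?thesis .
qed

lemma prime_avg_eq_sum:
  "prime_avg n k lam f l = (\<Sum>x\<in>prime_vecs n k lam. prime_kernel n k lam x * f (vec_diff n x l))"
  unfolding prime_avg_def sum_distrib_left by (intro sum.cong) (simp_all add: prime_kernel_def)

text \<open>The average reads f at p - l, a convolution reads it at l - p; composing f with y
  \<mapsto> -y reconciles the two without changing any \<ell>^p norm.\<close>

lemma prime_avg_eq_convolve:
  assumes "k \<ge> 1"
  shows "prime_avg n k lam f l = convolve n (prime_kernel n k lam) (\<lambda>y. f (vec_diff n (\<lambda>_. 0) y)) l"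
proof -
  have "convolve n (prime_kernel n k lam) (\<lambda>y. f (vec_diff n (\<lambda>_. 0) y)) l =
      (\<Sum>\<^sub>\<infinity>x\<in>prime_vecs n k lam. prime_kernel n k lam x * f (vec_diff n (\<lambda>_. 0) (vec_diff n l x)))"
    unfolding convolve_def by (rule infsum_cong_neutral) (auto simp: prime_kernel_def prime_vecs_def)
  moreover have "vec_diff n (\<lambda>_. 0) (vec_diff n l x) = vec_diff n x l" for x
    by (auto simp: vec_diff_def)
  ultimately show ?thesis
    unfolding prime_avg_eq_sum by (simp add: finite_prime_vecs[OF assms])
qed

text \<open>Schur's test: the arithmetic-geometric mean inequality on |a l| |a y| splits the form
  into row sums and column sums of |G|.\<close>

lemma cmod_sum_bilinear_schur:
  assumes "finite A" "\<And>l. l \<in> A \<Longrightarrow> (\<Sum>y\<in>A. cmod (G l y)) \<le> 1" "\<And>y. y \<in> A \<Longrightarrow> (\<Sum>l\<in>A. cmod (G l y)) \<le> 1"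
  shows "cmod (\<Sum>l\<in>A. \<Sum>y\<in>A. cnj (a l) * a y * G l y) \<le> (\<Sum>y\<in>A. (cmod (a y))\<^sup>2)"
proof -
  have amgm: "u * v \<le> u\<^sup>2 / 2 + v\<^sup>2 / 2" for u v :: real
    using sum_squares_bound[of u v] by simp
  have "cmod (\<Sum>l\<in>A. \<Sum>y\<in>A. cnj (a l) * a y * G l y) \<le> (\<Sum>l\<in>A. \<Sum>y\<in>A. cmod (a l) * cmod (a y) * cmod (G l y))"
    by (intro order_trans[OF norm_sum] sum_mono) (simp add: norm_mult)
  also have "\<dots> \<le> (\<Sum>l\<in>A. \<Sum>y\<in>A. ((cmod (a l))\<^sup>2 / 2 + (cmod (a y))\<^sup>2 / 2) * cmod (G l y))"
    by (intro sum_mono mult_right_mono amgm) auto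
  also have "\<dots> = (\<Sum>l\<in>A. (cmod (a l))\<^sup>2 / 2 * (\<Sum>y\<in>A. cmod (G l y))) + (\<Sum>y\<in>A. (cmod (a y))\<^sup>2 / 2 * (\<Sum>l\<in>A. cmod (G l y)))"
    unfolding distrib_right sum.distrib sum_distrib_left by (subst (2) sum.swap) simp
  also have "\<dots> \<le> (\<Sum>l\<in>A. (cmod (a l))\<^sup>2 / 2 * 1) + (\<Sum>y\<in>A. (cmod (a y))\<^sup>2 / 2 * 1)"
    by (intro add_mono sum_mono mult_left_mono assms) auto
  finally show ?thesis by (simp add: sum_divide_distrib[symmetric])
qed

lemma lp_finite_support:
  fixes f :: "(nat \<Rightarrow> int) \<Rightarrow> complex"
  assumes "finite Y" "Y \<subseteq> int_vecs n" "\<And>y. y \<in> int_vecs n - Y \<Longrightarrow> f y = 0" "p > 0"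
  shows "f \<in> lp_space n p" "lp_norm n p f = (\<Sum>y\<in>Y. cmod (f y) powr p) powr (1 / p)"
proof -
  have "(\<lambda>x. norm (f x) powr p) summable_on int_vecs n \<longleftrightarrow> (\<lambda>x. norm (f x) powr p) summable_on Y"
    by (rule summable_on_cong_neutral) (use assms in auto)
  then show "f \<in> lp_space n p" using assms(1) by (simp add: lp_space_def)
  have "(\<Sum>\<^sub>\<infinity>x\<in>int_vecs n. norm (f x) powr p) = (\<Sum>\<^sub>\<infinity>x\<in>Y. norm (f x) powr p)"
    by (rule infsum_cong_neutral) (use assms in auto)
  then show "lp_norm n p f = (\<Sum>y\<in>Y. cmod (f y) powr p) powr (1 / p)"
    using assms(1) by (simp add: lp_norm_def)
qed

text \<open>Turns the \<ell>^2 hypothesis into finite sums: f has finite support, and restricting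
  the output to L only drops nonnegative terms.\<close>

lemma lp_bounded_2_finite_support:
  assumes "lp_bounded n 2 2 T \<kappa>"
    and Y: "finite Y" "Y \<subseteq> int_vecs n" "\<And>y. y \<in> int_vecs n - Y \<Longrightarrow> f y = 0"
    and L: "finite L" "L \<subseteq> int_vecs n"
  shows "(\<Sum>l\<in>L. (T f l)\<^sup>2) \<le> \<kappa>\<^sup>2 * (\<Sum>y\<in>Y. (cmod (f y))\<^sup>2)"
proof -
  have f: "f \<in> lp_space n 2" "lp_norm n 2 f = sqrt (\<Sum>y\<in>Y. (cmod (f y))\<^sup>2)"
    using lp_finite_support[OF Y] by (auto simp: powr_half_sqrt sum_nonneg)
  have T: "T f \<in> lp_space n 2" "lp_norm n 2 (T f) \<le> \<kappa> * lp_norm n 2 f"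
    using assms(1) f(1) unfolding lp_bounded_def by auto
  have "(\<Sum>l\<in>L. (T f l)\<^sup>2) = (\<Sum>l\<in>L. norm (T f l) powr 2)" by simp
  also have "\<dots> \<le> (\<Sum>\<^sub>\<infinity>l\<in>int_vecs n. norm (T f l) powr 2)"
    by (rule finite_sum_le_infsum) (use T(1) L in \<open>auto simp: lp_space_def\<close>)
  also have "\<dots> = (lp_norm n 2 (T f))\<^sup>2"
    unfolding lp_norm_def by (simp add: powr_half_sqrt infsum_nonneg)
  also have "\<dots> \<le> (\<kappa> * lp_norm n 2 f)\<^sup>2"
    by (rule power_mono[OF T(2)]) (simp add: lp_norm_def)
  also have "\<dots> = \<kappa>\<^sup>2 * (\<Sum>y\<in>Y. (cmod (f y))\<^sup>2)"
    by (simp add: f(2) power_mult_distrib sum_nonneg)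
  finally show ?thesis .
qed

lemma cutoff_fun_support:
  assumes "cutoff_fun n \<psi>" "v \<in> real_vecs n" "\<psi> v \<noteq> 0" "i < n"
  shows "\<bar>v i\<bar> \<le> 2"
proof -
  have "0 \<le> \<psi> v"
    using assms(1,2) unfolding cutoff_fun_def by (metis indicator_pos_le order_trans)
  then have "(\<lambda>i\<in>{..<n}. v i / 2) \<in> {..<n} \<rightarrow>\<^sub>E {-1..1}"
    using assms(1-3) unfolding cutoff_fun_def by (metis indicator_simps(2) order_antisym)
  from PiE_mem[OF this, of i] show ?thesis using assms(4) by (simp add: abs_le_iff)
qed

text \<open>A nonzero value forces some cutoff in the sum to be nonzero, so (N/Q) |q_i \<xi>_i -
  a_i| \<le> 2 for some q_i \<le> Q. Multiplying by 2 pi Q/N gives the width 4 pi Q/N that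
  \<open>arc_cut_eq_1\<close> asks for.\<close>

lemma main_mult_support:
  assumes "cutoff_fun n \<psi>" "N > 0" "Q > 0" "main_mult n k \<psi> N Q lam \<xi> \<noteq> 0" "i < n"
  shows "arc_cut (nat \<lfloor>Q\<rfloor>) (4 * pi * Q / N) (ee (\<xi> i)) = 1"
proof -
  have "\<exists>q\<in>{..<n} \<rightarrow>\<^sub>E {q :: nat. 1 \<le> q \<and> real q \<le> Q}.
      \<exists>a. \<psi> (\<lambda>i\<in>{..<n}. N / Q * (real (q i) * \<xi> i - real_of_int (a i))) \<noteq> 0"
  proof (rule ccontr)
    assume "\<not> ?thesis"
    then have "main_mult n k \<psi> N Q lam \<xi> = 0"
      unfolding main_mult_def by (intro mult_eq_0_iff[THEN iffD2] disjI2 sum.neutral) simp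
    then show False using assms(4) by simp
  qed
  then obtain q a where q: "q \<in> {..<n} \<rightarrow>\<^sub>E {q :: nat. 1 \<le> q \<and> real q \<le> Q}"
    and a: "\<psi> (\<lambda>i\<in>{..<n}. N / Q * (real (q i) * \<xi> i - real_of_int (a i))) \<noteq> 0"
    by blast
  have mem: "(\<lambda>i\<in>{..<n}. N / Q * (real (q i) * \<xi> i - real_of_int (a i))) \<in> real_vecs n"
    unfolding real_vecs_def by (simp add: restrict_PiE_iff)
  define r where "r = \<bar>real (q i) * \<xi> i - real_of_int (a i)\<bar>"
  have "N / Q * r \<le> 2"
    using cutoff_fun_support[OF assms(1) mem a assms(5)] assms(2,3,5) by (simp add: r_def abs_mult)
  then have "2 * pi * r \<le> 4 * pi * Q / N"
    using assms(2,3) by (simp add: field_simps)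
  moreover have "1 \<le> q i" "q i \<le> nat \<lfloor>Q\<rfloor>"
    using q assms(5) by (auto simp: PiE_iff le_nat_floor)
  ultimately show ?thesis
    using assms(2,3) by (intro arc_cut_eq_1) (auto simp: r_def)
qed

text \<open>Neither the singular series nor the surface measure is estimated: the bounds for the two
  operators on \<open>\<ell>\<^sup>2\<close> bound the multiplier by 2, and the size of its support does the rest.\<close>

lemma main_kernel_bound:
  assumes \<psi>: "cutoff_fun n \<psi>" and N: "N > 0" and Q: "Q > 0" and k: "k \<ge> 1"
    and pc: "prime_count n k lam > 0"
    and E: "\<And>f Y L. finite Y \<Longrightarrow> Y \<subseteq> int_vecs n \<Longrightarrow> (\<And>y. y \<in> int_vecs n - Y \<Longrightarrow> f y = 0) \<Longrightarrow>
      finite L \<Longrightarrow> L \<subseteq> int_vecs n \<Longrightarrow>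
      (\<Sum>l\<in>L. (cmod (error_op n k \<psi> N Q lam f l))\<^sup>2) \<le> (\<Sum>y\<in>Y. (cmod (f y))\<^sup>2)"
  shows "cmod (main_kernel n k \<psi> N Q lam x0) \<le> 2 * (32 * pi * Q\<^sup>2 / N) ^ n"
proof -
  define \<delta> where "\<delta> = 4 * pi * Q / N"
  have \<delta>: "\<delta> > 0" using N Q by (simp add: \<delta>_def)
  define F where "F = arc_cut (nat \<lfloor>Q\<rfloor>) \<delta>"
  define C where "C = {..<n} \<rightarrow>\<^sub>E {0..1::real}"
  define f where "f \<xi> = indicator C \<xi> *\<^sub>R main_mult n k \<psi> N Q lam \<xi>" for \<xi>
  define K where "K = main_kernel n k \<psi> N Q lam"
  define P where "P = prime_kernel n k lam"
  define \<tau> where "\<tau> l = (\<lambda>i\<in>{..<n}. l i + x0 i)" for l :: "nat \<Rightarrow> int"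
  have \<tau>_in: "\<tau> ` A \<subseteq> int_vecs n" for A
    unfolding \<tau>_def[abs_def] int_vecs_def by (rule image_subsetI) (simp add: restrict_PiE_iff)
  have K: "K x = (LINT \<xi>|(\<Pi>\<^sub>M i\<in>{..<n}. lborel). f \<xi> * ee (- (\<Sum>i<n. real_of_int (x i) * \<xi> i)))" for x
    by (simp add: K_def main_kernel_def set_lebesgue_integral_def f_def C_def)
  \<comment> \<open>Write K = P - (P - K). The form of P is bounded by Schur's test, that of P - K
    by \<open>E\<close> applied to the zero extension \<open>h\<close> of the test sequence; each
    contributes the squared norm, hence the factor 2.\<close>
  have bil: "cmod (\<Sum>l\<in>A. \<Sum>y\<in>A. cnj (a l) * a y * K (vec_diff n (\<tau> l) y)) \<le> 2 * (\<Sum>y\<in>A. (cmod (a y))\<^sup>2)"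
    if A: "finite A" "A \<subseteq> int_vecs n" for A and a :: "(nat \<Rightarrow> int) \<Rightarrow> complex"
  proof -
    define h where "h y = (if y \<in> A then a y else 0)" for y
    define v where "v = error_op n k \<psi> N Q lam h"
    have v: "v l = (\<Sum>y\<in>A. (P (vec_diff n l y) - K (vec_diff n l y)) * a y)" for l
      unfolding v_def error_op_def P_def K_def
      by (subst convolve_finite_support[OF A]) (auto simp: h_def)
    have "(\<Sum>l\<in>A. \<Sum>y\<in>A. cnj (a l) * a y * K (vec_diff n (\<tau> l) y)) =
       (\<Sum>l\<in>A. \<Sum>y\<in>A. cnj (a l) * a y * P (vec_diff n (\<tau> l) y)) - (\<Sum>l\<in>A. cnj (a l) * v (\<tau> l))"
      unfolding v by (simp add: sum_distrib_left algebra_simps flip: sum_subtractf)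
    moreover have "cmod (\<Sum>l\<in>A. \<Sum>y\<in>A. cnj (a l) * a y * P (vec_diff n (\<tau> l) y)) \<le> (\<Sum>y\<in>A. (cmod (a y))\<^sup>2)"
    proof (rule cmod_sum_bilinear_schur[OF A(1)])
      show "(\<Sum>y\<in>A. cmod (P (vec_diff n (\<tau> l) y))) \<le> 1" for l
        using sum_prime_kernel_le_1[OF k pc finite_imageI[OF A(1)], of "vec_diff n (\<tau> l)"]
        by (simp add: sum.reindex inj_on_vec_diff[OF A(2)] P_def)
      show "(\<Sum>l\<in>A. cmod (P (vec_diff n (\<tau> l) y))) \<le> 1" for y
        using sum_prime_kernel_le_1[OF k pc finite_imageI[OF A(1)], of "\<lambda>l. vec_diff n (\<tau> l) y"]
        by (simp add: sum.reindex inj_on_vec_diff_left[OF A(2)] P_def \<tau>_def)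
    qed
    moreover have "cmod (\<Sum>l\<in>A. cnj (a l) * v (\<tau> l)) \<le> (\<Sum>y\<in>A. (cmod (a y))\<^sup>2)"
    proof -
      have "(\<Sum>l\<in>A. (cmod (v (\<tau> l)))\<^sup>2) = (\<Sum>l\<in>\<tau> ` A. (cmod (v l))\<^sup>2)"
        using inj_on_vec_add[OF A(2), of x0] by (simp add: sum.reindex \<tau>_def[abs_def])
      also have "\<dots> \<le> (\<Sum>y\<in>A. (cmod (h y))\<^sup>2)"
        unfolding v_def by (rule E) (use A \<tau>_in in \<open>auto simp: h_def\<close>)
      also have "\<dots> = (\<Sum>y\<in>A. (cmod (a y))\<^sup>2)" by (simp add: h_def)
      finally have v2: "(\<Sum>l\<in>A. (cmod (v (\<tau> l)))\<^sup>2) \<le> (\<Sum>y\<in>A. (cmod (a y))\<^sup>2)" .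
      have "cmod (\<Sum>l\<in>A. cnj (a l) * v (\<tau> l)) \<le> (\<Sum>l\<in>A. ((cmod (a l))\<^sup>2 + (cmod (v (\<tau> l)))\<^sup>2) / 2)"
      proof (intro order_trans[OF norm_sum] sum_mono)
        show "cmod (cnj (a l) * v (\<tau> l)) \<le> ((cmod (a l))\<^sup>2 + (cmod (v (\<tau> l)))\<^sup>2) / 2" for l
          using sum_squares_bound[of "cmod (a l)" "cmod (v (\<tau> l))"] by (simp add: norm_mult)
      qed
      also have "\<dots> \<le> (\<Sum>y\<in>A. (cmod (a y))\<^sup>2)"
        using v2 by (simp add: sum.distrib flip: sum_divide_distrib)
      finally show ?thesis .
    qed
    ultimately show ?thesis by (smt (verit) norm_triangle_ineq4)
  qed
  have "cmod (K x0) \<le> 2 * integral {0..1} (\<lambda>x. F (ee x)) ^ n"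
  proof (rule bounded_multiplier_kernel[OF K bil[unfolded \<tau>_def]])
    show "F (ee (\<xi> i)) = 1" if "f \<xi> \<noteq> 0" "i < n" for \<xi> i
      unfolding F_def \<delta>_def using that by (intro main_mult_support[OF \<psi> N Q]) (auto simp: f_def)
  qed (auto simp: F_def arc_cut_nonneg arc_cut_le_1 continuous_on_arc_cut[OF \<delta>])
  also have "\<dots> \<le> 2 * (32 * pi * Q\<^sup>2 / N) ^ n"
  proof (intro mult_left_mono power_mono)
    have "integral {0..1} (\<lambda>x. F (ee x)) \<le> 8 * real (nat \<lfloor>Q\<rfloor>) * \<delta>"
      unfolding F_def by (rule integral_arc_cut[OF \<delta>])
    also have "\<dots> \<le> 8 * Q * \<delta>"
      using \<delta> Q by (intro mult_right_mono mult_left_mono) (auto simp: of_nat_nat)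
    \<comment> \<open>8 comes from \<open>integral_arc_cut\<close>, 4 pi from \<delta>.\<close>
    also have "\<dots> = 32 * pi * Q\<^sup>2 / N" by (simp add: \<delta>_def power2_eq_square)
    finally show "integral {0..1} (\<lambda>x. F (ee x)) \<le> 32 * pi * Q\<^sup>2 / N" .
    show "0 \<le> integral {0..1} (\<lambda>x. F (ee x))"
      unfolding F_def
      by (intro Henstock_Kurzweil_Integration.integral_nonneg integrable_continuous_real
         continuous_on_compose2[OF continuous_on_arc_cut[OF \<delta>]])
         (auto intro!: continuous_intros simp: arc_cut_nonneg)
  qed auto
  finally show ?thesis by (simp add: K_def)
qed

subsection \<open>Localization to cubes\<close>

text \<open>Every term is at most the maximum, whose power is one of the summands on the right. The
  loss is harmless: \<open>card S\<close> is either 2 or the number of dyadic levels.\<close>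

lemma powr_sum_le:
  fixes t :: "'a \<Rightarrow> real"
  assumes "finite S" "\<And>i. i \<in> S \<Longrightarrow> 0 \<le> t i" "0 < q"
  shows "(\<Sum>i\<in>S. t i) powr q \<le> real (card S) powr q * (\<Sum>i\<in>S. t i powr q)"
proof (cases "S = {}")
  case False
  define m where "m = Max (t ` S)"
  obtain i where i: "i \<in> S" "m = t i"
    using Max_in[of "t ` S"] assms(1) False unfolding m_def by fastforce
  have "(\<Sum>i\<in>S. t i) \<le> real (card S) * m"
    by (rule sum_bounded_above) (use assms(1) in \<open>simp add: m_def\<close>)
  then have "(\<Sum>i\<in>S. t i) powr q \<le> (real (card S) * m) powr q"
    using assms by (intro powr_mono2) (auto intro: sum_nonneg)
  also have "\<dots> = real (card S) powr q * m powr q"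
    using assms(2) i by (simp add: powr_mult)
  also have "m powr q \<le> (\<Sum>i\<in>S. t i powr q)"
    unfolding i(2) using assms(1) i(1) by (intro member_le_sum) auto
  finally show ?thesis by (simp add: mult_left_mono)
qed simp

text \<open>With s the total, t_i^r \<le> t_i s^(r-1). This adds up local bounds over cells when p
  \<le> p'.\<close>

lemma sum_powr_le_powr_sum:
  fixes t :: "'a \<Rightarrow> real"
  assumes "\<And>i. i \<in> S \<Longrightarrow> 0 \<le> t i" "1 \<le> r"
  shows "(\<Sum>i\<in>S. t i powr r) \<le> (\<Sum>i\<in>S. t i) powr r"
proof (cases "finite S")
  case True
  define s where "s = (\<Sum>i\<in>S. t i)"
  have s: "0 \<le> s" using assms(1) by (auto simp: s_def intro: sum_nonneg)
  have "t i powr r \<le> t i * s powr (r - 1)" if i: "i \<in> S" for i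
  proof -
    have "t i \<le> s" unfolding s_def using True i assms(1) by (intro member_le_sum) auto
    then have "t i powr (r - 1) \<le> s powr (r - 1)" using i assms by (intro powr_mono2) auto
    then have "t i * t i powr (r - 1) \<le> t i * s powr (r - 1)" using i assms(1) by (intro mult_left_mono)
    moreover have "t i * t i powr (r - 1) = t i powr r"
      using i assms by (cases "t i = 0") (auto simp: powr_mult_base)
    ultimately show ?thesis by simp
  qed
  then have "(\<Sum>i\<in>S. t i powr r) \<le> (\<Sum>i\<in>S. t i * s powr (r - 1))" by (rule sum_mono)
  also have "\<dots> = s * s powr (r - 1)" by (simp add: s_def sum_distrib_right)
  also have "\<dots> = s powr r" using s by (cases "s = 0") (auto simp: powr_mult_base)
  finally show ?thesis by (simp add: s_def)
qed simp

text \<open>A point l sees f only on the cube [0, W)^n translated by -l. Hence all l in one cell of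
  side W see f only on a common box of side 2W, the local estimate applies to f cut off to that box,
  and each point lies in at most 2^n boxes. Since p \<le> p', the cell contributions can be
  summed.\<close>

lemma lp_localize:
  fixes T :: "((nat \<Rightarrow> int) \<Rightarrow> complex) \<Rightarrow> (nat \<Rightarrow> int) \<Rightarrow> real" and W :: int
  assumes W: "W > 0" and p: "0 < p" "p \<le> p'" and Kc: "0 \<le> Kc"
    and loc: "\<And>f g l. l \<in> int_vecs n \<Longrightarrow>
      (\<And>x. x \<in> {..<n} \<rightarrow>\<^sub>E {0..<W} \<Longrightarrow> f (vec_diff n x l) = g (vec_diff n x l)) \<Longrightarrow> T f l = T g l"
    and est: "\<And>f Y L. finite Y \<Longrightarrow> Y \<subseteq> int_vecs n \<Longrightarrow> (\<And>y. y \<notin> Y \<Longrightarrow> f y = 0) \<Longrightarrow>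
      real (card Y) \<le> (2 * real_of_int W) ^ n \<Longrightarrow> finite L \<Longrightarrow> L \<subseteq> int_vecs n \<Longrightarrow>
      real (card L) \<le> (2 * real_of_int W) ^ n \<Longrightarrow>
      (\<Sum>l\<in>L. \<bar>T f l\<bar> powr p') \<le> Kc * (\<Sum>y\<in>Y. cmod (f y) powr p) powr (p' / p)"
  shows "lp_bounded n p p' T ((Kc * (2 ^ n) powr (p' / p)) powr (1 / p'))"
  unfolding lp_bounded_def
proof
  fix f :: "(nat \<Rightarrow> int) \<Rightarrow> complex" assume f: "f \<in> lp_space n p"
  have r: "1 \<le> p' / p" using p by simp
  \<comment> \<open>If l_i lies in [W j_i, W j_i + W) and x_i in [0, W), then x_i - l_i lies in this
    interval of length 2W.\<close>
  define Y where "Y j = (\<Pi>\<^sub>E i\<in>{..<n}. {- W * (j i + 1)..<W - W * j i})" for j :: "nat \<Rightarrow> int"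
  define cell where "cell l = (\<lambda>i\<in>{..<n}. l i div W)" for l :: "nat \<Rightarrow> int"
  define \<Phi> where "\<Phi> = (\<Sum>\<^sub>\<infinity>y\<in>int_vecs n. cmod (f y) powr p)"
  have \<Phi>: "0 \<le> \<Phi>" unfolding \<Phi>_def by (rule infsum_nonneg) simp
  have finY: "finite (Y j)" for j unfolding Y_def by (rule finite_PiE) auto
  have Y_sub: "Y j \<subseteq> int_vecs n" for j unfolding Y_def int_vecs_def by (rule PiE_mono) auto
  have cardY: "real (card (Y j)) = (2 * real_of_int W) ^ n" for j
  proof -
    have "card (Y j) = (\<Prod>i<n. card {- W * (j i + 1)..<W - W * j i})"
      unfolding Y_def by (rule card_PiE) simp
    also have "\<dots> = (\<Prod>i<n. nat (2 * W))" by (simp add: algebra_simps)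
    finally show ?thesis using W by simp
  qed
  have bound: "(\<Sum>l\<in>F. \<bar>T f l\<bar> powr p') \<le> Kc * (2 ^ n * \<Phi>) powr (p' / p)"
    if F: "finite F" "F \<subseteq> int_vecs n" for F
  proof -
    define J where "J = cell ` F"
    have J: "finite J" using F by (simp add: J_def)
    define U where "U = (\<Union>j\<in>J. Y j)"
    have U: "finite U" "U \<subseteq> int_vecs n" using J finY Y_sub by (auto simp: U_def)
    have cell_est: "(\<Sum>l\<in>{l\<in>F. cell l = j}. \<bar>T f l\<bar> powr p') \<le> Kc * (\<Sum>y\<in>Y j. cmod (f y) powr p) powr (p' / p)" for j
    proof -
      define g where "g y = (if y \<in> Y j then f y else 0)" for y
      define L where "L = {l\<in>F. cell l = j}"
      have coord: "W * j i \<le> l i \<and> l i < W * j i + W" if "l \<in> L" "i < n" for l i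
      proof -
        have "j i = l i div W" using that by (auto simp: L_def cell_def)
        then have "l i = W * j i + l i mod W" by simp
        moreover have "0 \<le> l i mod W" "l i mod W < W" using W by auto
        ultimately show ?thesis by linarith
      qed
      have "T f l = T g l" if l: "l \<in> L" for l
      proof (rule loc)
        show "l \<in> int_vecs n" using l F by (auto simp: L_def)
        fix x assume x: "x \<in> {..<n} \<rightarrow>\<^sub>E {0..<W}"
        have "x i - l i \<in> {- W * (j i + 1)..<W - W * j i}" if i: "i < n" for i
        proof -
          have "0 \<le> x i" "x i < W" using PiE_mem[OF x, of i] i by auto
          then show ?thesis using coord[OF l i] by (auto simp: algebra_simps)
        qed
        then have "vec_diff n x l \<in> Y j" unfolding vec_diff_def Y_def by (simp add: restrict_PiE_iff)
        then show "f (vec_diff n x l) = g (vec_diff n x l)" by (simp add: g_def)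
      qed
      then have "(\<Sum>l\<in>L. \<bar>T f l\<bar> powr p') = (\<Sum>l\<in>L. \<bar>T g l\<bar> powr p')" by simp
      also have "\<dots> \<le> Kc * (\<Sum>y\<in>Y j. cmod (g y) powr p) powr (p' / p)"
      proof (rule est)
        have "L \<subseteq> (\<Pi>\<^sub>E i\<in>{..<n}. {W * j i..<W * j i + W})"
        proof
          fix l assume l: "l \<in> L"
          then have "l \<in> int_vecs n" using F by (auto simp: L_def)
          then show "l \<in> (\<Pi>\<^sub>E i\<in>{..<n}. {W * j i..<W * j i + W})"
            using coord[OF l] by (auto simp: int_vecs_def PiE_iff)
        qed
        then have "card L \<le> card (\<Pi>\<^sub>E i\<in>{..<n}. {W * j i..<W * j i + W})"
          by (intro card_mono finite_PiE) auto
        also have "\<dots> = nat W ^ n" by (simp add: card_PiE)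
        finally have "real (card L) \<le> real_of_int W ^ n" using W
          by (metis of_nat_le_iff of_nat_nat of_nat_power order_less_imp_le)
        also have "\<dots> \<le> (2 * real_of_int W) ^ n" using W by (intro power_mono) auto
        finally show "real (card L) \<le> (2 * real_of_int W) ^ n" .
      qed (use F finY Y_sub cardY in \<open>auto simp: L_def g_def\<close>)
      also have "(\<Sum>y\<in>Y j. cmod (g y) powr p) = (\<Sum>y\<in>Y j. cmod (f y) powr p)" by (simp add: g_def)
      finally show ?thesis by (simp add: L_def)
    qed
    have "(\<Sum>l\<in>F. \<bar>T f l\<bar> powr p') = (\<Sum>j\<in>J. \<Sum>l\<in>{l\<in>F. cell l = j}. \<bar>T f l\<bar> powr p')"
      unfolding J_def by (rule sum.image_gen[OF F(1)])
    also have "\<dots> \<le> (\<Sum>j\<in>J. Kc * (\<Sum>y\<in>Y j. cmod (f y) powr p) powr (p' / p))"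
      by (rule sum_mono[OF cell_est])
    also have "\<dots> = Kc * (\<Sum>j\<in>J. (\<Sum>y\<in>Y j. cmod (f y) powr p) powr (p' / p))"
      by (simp add: sum_distrib_left)
    also have "\<dots> \<le> Kc * (\<Sum>j\<in>J. \<Sum>y\<in>Y j. cmod (f y) powr p) powr (p' / p)"
      by (intro mult_left_mono sum_powr_le_powr_sum r Kc sum_nonneg) auto
    also have "\<dots> \<le> Kc * (2 ^ n * \<Phi>) powr (p' / p)"
    proof (intro mult_left_mono Kc powr_mono2)
      have "(\<Sum>j\<in>J. \<Sum>y\<in>Y j. cmod (f y) powr p) = (\<Sum>j\<in>J. \<Sum>y\<in>{y\<in>U. y \<in> Y j}. cmod (f y) powr p)"
        by (intro sum.cong refl) (auto simp: U_def)
      also have "\<dots> = (\<Sum>y\<in>U. \<Sum>j\<in>{j\<in>J. y \<in> Y j}. cmod (f y) powr p)"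
        by (rule sum.swap_restrict[OF J U(1)])
      also have "\<dots> \<le> (\<Sum>y\<in>U. 2 ^ n * (cmod (f y) powr p))"
      proof (rule sum_mono)
        fix y
        \<comment> \<open>With y_i = W q + r, membership in \<open>Y j\<close> gives -q - 2 < j_i <
          1 - q: two choices per coordinate.\<close>
        have "{j\<in>J. y \<in> Y j} \<subseteq> (\<Pi>\<^sub>E i\<in>{..<n}. {- (y i div W) - 1, - (y i div W)})"
        proof
          fix j assume "j \<in> {j\<in>J. y \<in> Y j}"
          then have j: "j \<in> J" "y \<in> Y j" by auto
          have "j i \<in> {- (y i div W) - 1, - (y i div W)}" if i: "i < n" for i
          proof -
            have y: "- W * (j i + 1) \<le> y i" "y i < W - W * j i"
              using PiE_mem[OF j(2)[unfolded Y_def], of i] i by auto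
            define q where "q = y i div W"
            define r where "r = y i mod W"
            have yW: "y i = W * q + r" "0 \<le> r" "r < W"
              using W by (auto simp: q_def r_def)
            have "W * (- (j i + 1)) < W * (q + 1)" using y(1) yW by (simp add: algebra_simps)
            then have 1: "- (j i + 1) < q + 1" using W by simp
            have "W * q < W * (1 - j i)" using y(2) yW by (simp add: algebra_simps)
            then have 2: "q < 1 - j i" using W by simp
            show ?thesis using 1 2 by (auto simp flip: q_def)
          qed
          moreover have "j \<in> extensional {..<n}" using j(1) by (auto simp: J_def cell_def)
          ultimately show "j \<in> (\<Pi>\<^sub>E i\<in>{..<n}. {- (y i div W) - 1, - (y i div W)})"
            by (simp add: PiE_iff)
        qed
        then have "card {j\<in>J. y \<in> Y j} \<le> card (\<Pi>\<^sub>E i\<in>{..<n}. {- (y i div W) - 1, - (y i div W)})"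
          by (intro card_mono finite_PiE) auto
        also have "\<dots> = 2 ^ n" by (simp add: card_PiE numeral_2_eq_2)
        finally have "real (card {j\<in>J. y \<in> Y j}) \<le> real (2 ^ n)" by (rule of_nat_mono)
        then show "(\<Sum>j\<in>{j\<in>J. y \<in> Y j}. cmod (f y) powr p) \<le> 2 ^ n * (cmod (f y) powr p)"
          by (simp add: mult_right_mono)
      qed
      also have "\<dots> = 2 ^ n * (\<Sum>y\<in>U. cmod (f y) powr p)" by (simp add: sum_distrib_left)
      also have "(\<Sum>y\<in>U. cmod (f y) powr p) \<le> \<Phi>"
        unfolding \<Phi>_def by (rule finite_sum_le_infsum) (use f U in \<open>auto simp: lp_space_def\<close>)
      finally show "(\<Sum>j\<in>J. \<Sum>y\<in>Y j. cmod (f y) powr p) \<le> 2 ^ n * \<Phi>" by simp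
    qed (use r in \<open>auto intro!: sum_nonneg\<close>)
    finally show ?thesis .
  qed
  have summ: "(\<lambda>l. norm (T f l) powr p') summable_on int_vecs n"
    by (rule nonneg_bdd_above_summable_on) (use bound in \<open>auto intro!: bdd_aboveI2\<close>)
  have le: "(\<Sum>\<^sub>\<infinity>l\<in>int_vecs n. norm (T f l) powr p') \<le> Kc * (2 ^ n * \<Phi>) powr (p' / p)"
    by (rule infsum_le_finite_sums[OF summ]) (use bound in auto)
  have "lp_norm n p' (T f) \<le> (Kc * (2 ^ n * \<Phi>) powr (p' / p)) powr (1 / p')"
    unfolding lp_norm_def using le p by (intro powr_mono2 infsum_nonneg) auto
  also have "\<dots> = (Kc * (2 ^ n) powr (p' / p)) powr (1 / p') * lp_norm n p f"
    using p \<Phi> Kc by (simp add: lp_norm_def \<Phi>_def[symmetric] powr_mult powr_powr)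
  finally show "T f \<in> lp_space n p' \<and> lp_norm n p' (T f) \<le> (Kc * (2 ^ n) powr (p' / p)) powr (1 / p') * lp_norm n p f"
    using summ by (simp add: lp_space_def)
qed

subsection \<open>Interpolation by level sets\<close>

lemma conjugate_exponent:
  fixes p p' :: real
  assumes "1 < p" "p < 2" "1 / p + 1 / p' = 1"
  shows "p' = p / (p - 1)" "2 < p'" "p' / p = p' - 1"
proof -
  have "1 / p' = (p - 1) / p" using assms by (simp add: diff_divide_distrib)
  then have "inverse (1 / p') = inverse ((p - 1) / p)" by (rule arg_cong)
  then show *: "p' = p / (p - 1)" by simp
  show "2 < p'" "p' / p = p' - 1" using assms(1,2) unfolding * by (simp_all add: field_simps)
qed

text \<open>On a level set |g| equals a up to a factor 2, so all norms of g are governed by a and m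
  = \<open>card Z\<close>. Using the sup bound u \<le> 2 a m S for all but two powers of u reduces
  the p'-sum to the \<ell>^2 bound and leaves m^(p'-1) a^p' = (m a^p)^(p'/p).\<close>

lemma level_interpolation:
  fixes g :: "'a \<Rightarrow> complex" and u :: "'b \<Rightarrow> real"
  assumes Z: "finite Z" and a: "0 < a" and g: "\<And>z. z \<in> Z \<Longrightarrow> a \<le> cmod (g z) \<and> cmod (g z) \<le> 2 * a"
    and p: "1 < p" "p < 2" "1 / p + 1 / p' = 1"
    and u: "\<And>l. l \<in> L \<Longrightarrow> 0 \<le> u l" "\<And>l. l \<in> L \<Longrightarrow> u l \<le> S * (\<Sum>z\<in>Z. cmod (g z))"
    and u2: "(\<Sum>l\<in>L. (u l)\<^sup>2) \<le> \<kappa> * (\<Sum>z\<in>Z. (cmod (g z))\<^sup>2)"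
    and nonneg: "0 \<le> S" "0 \<le> \<kappa>"
  shows "(\<Sum>l\<in>L. u l powr p') \<le> 2 powr p' * S powr (p' - 2) * \<kappa> * (\<Sum>z\<in>Z. cmod (g z) powr p) powr (p' / p)"
proof -
  note p'2 = conjugate_exponent(2)[OF p] and p'p = conjugate_exponent(3)[OF p]
  define m where "m = real (card Z)"
  have m: "0 \<le> m" by (simp add: m_def)
  have s1: "(\<Sum>z\<in>Z. cmod (g z)) \<le> m * (2 * a)" "(\<Sum>z\<in>Z. (cmod (g z))\<^sup>2) \<le> m * (2 * a)\<^sup>2"
    unfolding m_def by (rule sum_bounded_above, use g in blast)
      (rule sum_bounded_above, rule power_mono, use g in auto)
  define D where "D = S * (m * (2 * a))"
  have D: "0 \<le> D" using nonneg m a by (simp add: D_def)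
  have "u l powr p' \<le> D powr (p' - 2) * (u l)\<^sup>2" if l: "l \<in> L" for l
  proof -
    have "u l \<le> D" unfolding D_def using u(2)[OF l] s1(1) nonneg by (meson mult_left_mono order_trans)
    then have "u l powr (p' - 2) * (u l)\<^sup>2 \<le> D powr (p' - 2) * (u l)\<^sup>2"
      using u(1)[OF l] p'2 by (intro mult_right_mono powr_mono2) auto
    moreover have "u l powr (p' - 2) * (u l)\<^sup>2 = u l powr p'"
    proof (cases "u l = 0")
      case False
      then show ?thesis using u(1)[OF l] by (simp add: powr_diff)
    qed simp
    ultimately show ?thesis by simp
  qed
  then have "(\<Sum>l\<in>L. u l powr p') \<le> (\<Sum>l\<in>L. D powr (p' - 2) * (u l)\<^sup>2)" by (rule sum_mono)
  also have "\<dots> = D powr (p' - 2) * (\<Sum>l\<in>L. (u l)\<^sup>2)" by (simp add: sum_distrib_left)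
  also have "\<dots> \<le> D powr (p' - 2) * (\<kappa> * (m * (2 * a)\<^sup>2))"
    using u2 s1(2) nonneg by (intro mult_left_mono) (auto intro: order_trans mult_left_mono)
  also have "\<dots> = 2 powr p' * S powr (p' - 2) * \<kappa> * (m powr (p' - 1) * a powr p')"
  proof (cases "m = 0")
    case False
    then have m: "0 < m" using m by simp
    have "D powr (p' - 2) = S powr (p' - 2) * m powr (p' - 2) * 2 powr (p' - 2) * a powr (p' - 2)"
      unfolding D_def using nonneg m a by (simp add: powr_mult)
    moreover have "m powr (p' - 2) * m = m powr (p' - 1)"
      using m by (simp add: powr_diff power2_eq_square)
    moreover have "2 powr (p' - 2) * a powr (p' - 2) * (2 * a)\<^sup>2 = 2 powr p' * a powr p'"
      using a by (simp add: powr_diff power_mult_distrib)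
    moreover have "S powr (p' - 2) * m powr (p' - 2) * 2 powr (p' - 2) * a powr (p' - 2) * (\<kappa> * (m * (2 * a)\<^sup>2)) =
        S powr (p' - 2) * \<kappa> * (m powr (p' - 2) * m) * (2 powr (p' - 2) * a powr (p' - 2) * (2 * a)\<^sup>2)"
      by (simp only: mult_ac)
    ultimately show ?thesis by (simp only: mult_ac)
  qed (use p p'2 in simp)
  also have "m powr (p' - 1) * a powr p' = (m * a powr p) powr (p' / p)"
    using m p by (simp add: powr_mult powr_powr flip: p'p)
  also have "\<dots> \<le> (\<Sum>z\<in>Z. cmod (g z) powr p) powr (p' / p)"
  proof (rule powr_mono2)
    show "m * a powr p \<le> (\<Sum>z\<in>Z. cmod (g z) powr p)"
      unfolding m_def using g a p by (intro sum_bounded_below powr_mono2) auto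
  qed (use m p p'2 in auto)
  finally show ?thesis using nonneg by (simp add: mult_left_mono)
qed

text \<open>The number \<open>I\<close> of dyadic levels costs only a power of a logarithm, so restricted estimates on
  level sets can replace complex interpolation.\<close>

lemma local_estimate:
  fixes T :: "('a \<Rightarrow> complex) \<Rightarrow> 'b \<Rightarrow> real" and I :: nat
  assumes Y: "finite Y" "real (card Y) \<le> V" and L: "finite L" "real (card L) \<le> V"
    and p: "1 < p" "p < 2" "1 / p + 1 / p' = 1"
    and nonneg: "0 \<le> D" "0 \<le> H" "0 \<le> S" "0 \<le> \<kappa>"
    and T0: "\<And>g l. l \<in> L \<Longrightarrow> 0 \<le> T g l"
    and Tsub: "\<And>g l. l \<in> L \<Longrightarrow> T (\<lambda>y. \<Sum>i\<le>I. g i y) l \<le> (\<Sum>i\<le>I. T (g i) l)"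
    and TD: "\<And>g l. l \<in> L \<Longrightarrow> (\<And>y. y \<notin> Y \<Longrightarrow> g y = 0) \<Longrightarrow> T g l \<le> D * (\<Sum>y\<in>Y. cmod (g y))"
    and Tu: "\<And>g. (\<And>y. y \<notin> Y \<Longrightarrow> g y = 0) \<Longrightarrow> \<exists>u. (\<forall>l\<in>L. 0 \<le> u l \<and> u l \<le> S * (\<Sum>y\<in>Y. cmod (g y)) \<and>
        T g l \<le> u l + H * (\<Sum>y\<in>Y. cmod (g y))) \<and> (\<Sum>l\<in>L. (u l)\<^sup>2) \<le> \<kappa> * (\<Sum>y\<in>Y. (cmod (g y))\<^sup>2)"
    and f: "\<And>y. y \<notin> Y \<Longrightarrow> f y = 0"
  shows "(\<Sum>l\<in>L. T f l powr p') \<le>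
    real (Suc I) powr p' * (real I * (2 powr p' * (2 powr p' * S powr (p' - 2) * \<kappa> + V * (2 * H) powr p' * V))
       + V * (D * V / 2 ^ I) powr p') * (\<Sum>y\<in>Y. cmod (f y) powr p) powr (p' / p)"
proof -
  note p'2 = conjugate_exponent(2)[OF p] and p'p = conjugate_exponent(3)[OF p]
  have V: "0 \<le> V" using Y(2) by linarith
  define \<Phi> where "\<Phi> = (\<Sum>y\<in>Y. cmod (f y) powr p) powr (p' / p)"
  have \<Phi>: "0 \<le> \<Phi>" by (simp add: \<Phi>_def)
  \<comment> \<open>The levels are counted down from the largest value of |f|; inserting 0 covers an
    empty Y.\<close>
  define \<mu> where "\<mu> = Max (insert 0 ((\<lambda>y. cmod (f y)) ` Y))"
  have \<mu>_ge: "cmod (f y) \<le> \<mu>" if "y \<in> Y" for y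
    unfolding \<mu>_def using Y that by (intro Max_ge) auto
  have \<mu>0: "0 \<le> \<mu>" unfolding \<mu>_def using Y by (intro Max_ge) auto
  have \<mu>_\<Phi>: "\<mu> powr p' \<le> \<Phi>"
  proof -
    have "\<mu> \<in> insert 0 ((\<lambda>y. cmod (f y)) ` Y)" unfolding \<mu>_def using Y by (intro Max_in) auto
    then consider "\<mu> = 0" | y where "y \<in> Y" "\<mu> = cmod (f y)" by blast
    then show ?thesis
    proof cases
      case 2
      have "\<mu> powr p' = (cmod (f y) powr p) powr (p' / p)" using p 2 by (simp add: powr_powr)
      also have "\<dots> \<le> \<Phi>" unfolding \<Phi>_def
        using Y 2 p p'2 by (intro powr_mono2 member_le_sum) auto
      finally show ?thesis .
    qed (use \<Phi> in simp)
  qed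
  \<comment> \<open>Level i < I collects \<mu>/2^(i+1) < |f| \<le> \<mu>/2^i. Level I takes
    everything smaller, zeros included; it has no lower bound, so only the trivial bound D applies
    to it.\<close>
  define lev where "lev y = (if f y = 0 then I else min I (nat \<lfloor>log 2 (\<mu> / cmod (f y))\<rfloor>))" for y
  define g where "g i y = (if y \<in> Y \<and> lev y = i then f y else 0)" for i y
  have g_Y: "g i y = 0" if "y \<notin> Y" for i y using that by (simp add: g_def)
  have f_eq: "f = (\<lambda>y. \<Sum>i\<le>I. g i y)"
  proof
    fix y
    have "lev y \<le> I" by (simp add: lev_def)
    then show "f y = (\<Sum>i\<le>I. g i y)" using f[of y] by (cases "y \<in> Y") (auto simp: g_def)
  qed
  have lev_lower: "\<mu> / 2 ^ Suc (lev y) \<le> cmod (f y)" if y: "y \<in> Y" "lev y < I" for y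
  proof -
    have nz: "f y \<noteq> 0" using y by (auto simp: lev_def split: if_splits)
    then have pos: "0 < cmod (f y)" by simp
    then have "0 < \<mu>" using \<mu>_ge[OF y(1)] by linarith
    note pos = pos this
    have "lev y = nat \<lfloor>log 2 (\<mu> / cmod (f y))\<rfloor>" using y(2) nz by (simp add: lev_def)
    then have "log 2 (\<mu> / cmod (f y)) < real (Suc (lev y))" by linarith
    then have "\<mu> / cmod (f y) < 2 powr real (Suc (lev y))" using pos by (simp add: log_less_iff)
    then show ?thesis using pos by (simp add: powr_realpow field_simps del: of_nat_Suc)
  qed
  have lev_upper: "cmod (f y) \<le> \<mu> / 2 ^ lev y" if y: "y \<in> Y" for y
  proof (cases "f y = 0")
    case False
    then have pos: "0 < cmod (f y)" by simp
    then have "0 < \<mu>" using \<mu>_ge[OF y] by linarith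
    note pos = pos this
    have "0 \<le> log 2 (\<mu> / cmod (f y))" using pos \<mu>_ge[OF y] by simp
    then have "real (lev y) \<le> log 2 (\<mu> / cmod (f y))" using False by (simp add: lev_def) linarith
    then have "2 powr real (lev y) \<le> \<mu> / cmod (f y)" using pos by (simp add: le_log_iff)
    then show ?thesis using pos by (simp add: powr_realpow field_simps)
  qed (use \<mu>0 in simp)
  define X where "X = 2 powr p' * (2 powr p' * S powr (p' - 2) * \<kappa> + V * (2 * H) powr p' * V)"
  have level: "(\<Sum>l\<in>L. T (g i) l powr p') \<le> X * \<Phi>" if i: "i < I" for i
  proof -
    define Z where "Z = {y\<in>Y. lev y = i}"
    define a where "a = \<mu> / 2 ^ Suc i"
    have Z: "finite Z" "Z \<subseteq> Y" using Y by (auto simp: Z_def)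
    have sumZ: "(\<Sum>y\<in>Y. F (g i y)) = (\<Sum>y\<in>Z. F (f y))" if "F 0 = 0" for F :: "complex \<Rightarrow> real"
      by (rule sum.mono_neutral_cong_right) (use Y that in \<open>auto simp: Z_def g_def\<close>)
    have fZ: "a \<le> cmod (f z) \<and> cmod (f z) \<le> 2 * a" if "z \<in> Z" for z
      using lev_lower[of z] lev_upper[of z] i that by (auto simp: Z_def a_def)
    define \<Phi>Z where "\<Phi>Z = (\<Sum>z\<in>Z. cmod (f z) powr p) powr (p' / p)"
    have \<Phi>Z: "\<Phi>Z \<le> \<Phi>" "0 \<le> \<Phi>Z" unfolding \<Phi>_def \<Phi>Z_def
      using Y Z p p'2 by (auto intro!: powr_mono2 sum_mono2 sum_nonneg)
    obtain u where u: "\<And>l. l \<in> L \<Longrightarrow> 0 \<le> u l" "\<And>l. l \<in> L \<Longrightarrow> u l \<le> S * (\<Sum>z\<in>Z. cmod (f z))"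
      "\<And>l. l \<in> L \<Longrightarrow> T (g i) l \<le> u l + H * (\<Sum>z\<in>Z. cmod (f z))"
      "(\<Sum>l\<in>L. (u l)\<^sup>2) \<le> \<kappa> * (\<Sum>z\<in>Z. (cmod (f z))\<^sup>2)"
      using Tu[of "g i", OF g_Y] sumZ[of cmod] sumZ[of "\<lambda>z. (cmod z)\<^sup>2"] by auto
    show ?thesis
    \<comment> \<open>\<open>level_interpolation\<close> requires a > 0. In the degenerate cases the
      \<ell>^1 norm of \<open>g i\<close> is 0, and the bounds through u force
      \<open>T (g i) l\<close> to vanish.\<close>
    proof (cases "\<mu> = 0 \<or> Z = {}")
      case True
      then have "(\<Sum>z\<in>Z. cmod (f z)) = 0" using fZ by (auto simp: a_def)
      then have "T (g i) l = 0" if "l \<in> L" for l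
        using u(2,3)[OF that] T0[OF that, of "g i"] by simp
      then have "(\<Sum>l\<in>L. T (g i) l powr p') = 0" by simp
      moreover have "0 \<le> X" unfolding X_def using nonneg V by auto
      ultimately show ?thesis using \<Phi> by simp
    next
      case False
      then have a: "0 < a" using \<mu>0 by (simp add: a_def)
      define m where "m = real (card Z)"
      have m: "0 < m" "m \<le> V" using False Z Y card_mono[OF Y(1) Z(2)] by (auto simp: m_def card_gt_0_iff)
      define h where "h = H * (\<Sum>z\<in>Z. cmod (f z))"
      have h0: "0 \<le> h" using nonneg by (simp add: h_def sum_nonneg)
      \<comment> \<open>m^p' a^p' = m (m a^p)^(p'/p) costs one factor m \<le> V; summing the
        constant h over L costs the second V.\<close>
      have h_le: "h powr p' \<le> (2 * H) powr p' * V * \<Phi>Z"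
      proof -
        have "(\<Sum>z\<in>Z. cmod (f z)) \<le> m * (2 * a)" unfolding m_def
          by (rule sum_bounded_above) (use fZ in auto)
        then have "h \<le> H * (m * (2 * a))" unfolding h_def using nonneg by (intro mult_left_mono)
        then have "h powr p' \<le> (H * (m * (2 * a))) powr p'" using h0 p'2 by (intro powr_mono2) auto
        also have "\<dots> = (2 * H) powr p' * (m powr p' * a powr p')"
          using nonneg m a by (simp add: powr_mult)
        also have "m powr p' = m * m powr (p' - 1)" using m by (simp add: powr_mult_base)
        also have "\<dots> * a powr p' = m * (m * a powr p) powr (p' / p)"
          using m p by (simp add: powr_mult powr_powr flip: p'p)
        also have "\<dots> \<le> V * \<Phi>Z"
        proof (intro mult_mono)
          show "(m * a powr p) powr (p' / p) \<le> \<Phi>Z"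
            unfolding \<Phi>Z_def m_def using fZ a p p'2 by (intro powr_mono2 sum_bounded_below) auto
        qed (use m V in auto)
        finally show ?thesis by (simp add: mult_left_mono mult.assoc)
      qed
      have "(\<Sum>l\<in>L. T (g i) l powr p') \<le> (\<Sum>l\<in>L. 2 powr p' * (u l powr p' + h powr p'))"
      proof (rule sum_mono)
        fix l assume l: "l \<in> L"
        have "T (g i) l powr p' \<le> (u l + h) powr p'"
          using u(3)[OF l] T0[OF l] p'2 by (intro powr_mono2) (auto simp: h_def)
        also have "\<dots> \<le> 2 powr p' * (u l powr p' + h powr p')"
          using powr_sum_le[of "{True, False}" "\<lambda>b. if b then u l else h" p'] u(1)[OF l] h0 p'2 by auto
        finally show "T (g i) l powr p' \<le> 2 powr p' * (u l powr p' + h powr p')" .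
      qed
      also have "\<dots> = 2 powr p' * ((\<Sum>l\<in>L. u l powr p') + real (card L) * h powr p')"
        by (simp add: sum.distrib flip: sum_distrib_left)
      also have "\<dots> \<le> 2 powr p' * (2 powr p' * S powr (p' - 2) * \<kappa> * \<Phi>Z + V * ((2 * H) powr p' * V * \<Phi>Z))"
      proof (intro mult_left_mono add_mono)
        show "(\<Sum>l\<in>L. u l powr p') \<le> 2 powr p' * S powr (p' - 2) * \<kappa> * \<Phi>Z"
          unfolding \<Phi>Z_def using level_interpolation[OF Z(1) a fZ p u(1,2,4) nonneg(3,4)] by simp
        show "real (card L) * h powr p' \<le> V * ((2 * H) powr p' * V * \<Phi>Z)"
          using L(2) h_le V by (intro mult_mono) auto
      qed simp
      also have "\<dots> = X * \<Phi>Z" by (simp add: X_def algebra_simps)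
      also have "\<dots> \<le> X * \<Phi>" unfolding X_def using nonneg V \<Phi>Z by (intro mult_left_mono) auto
      finally show ?thesis .
    qed
  qed
  \<comment> \<open>At most V points carry values up to \<mu>/2^I, and \<open>\<mu>_\<Phi>\<close>
    converts \<mu> back into the norm of f. I is later taken so large that 2^I absorbs D and
    V.\<close>
  have rest: "(\<Sum>l\<in>L. T (g I) l powr p') \<le> V * (D * V / 2 ^ I) powr p' * \<Phi>"
  proof -
    have "(\<Sum>y\<in>Y. cmod (g I y)) \<le> real (card Y) * (\<mu> / 2 ^ I)"
    proof (rule sum_bounded_above)
      show "cmod (g I y) \<le> \<mu> / 2 ^ I" if "y \<in> Y" for y
        using lev_upper[OF that] \<mu>0 by (auto simp: g_def)
    qed
    also have "\<dots> \<le> V * (\<mu> / 2 ^ I)" using Y(2) \<mu>0 by (intro mult_right_mono) auto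
    finally have "D * (\<Sum>y\<in>Y. cmod (g I y)) \<le> D * (V * (\<mu> / 2 ^ I))" using nonneg by (intro mult_left_mono)
    then have "T (g I) l \<le> D * V / 2 ^ I * \<mu>" if "l \<in> L" for l
      using TD[OF that, of "g I"] g_Y by (auto simp: mult.assoc)
    then have "(\<Sum>l\<in>L. T (g I) l powr p') \<le> real (card L) * (D * V / 2 ^ I * \<mu>) powr p'"
      using T0 p'2 by (intro sum_bounded_above powr_mono2) auto
    also have "\<dots> = real (card L) * ((D * V / 2 ^ I) powr p' * \<mu> powr p')"
      using nonneg V \<mu>0 by (subst powr_mult) auto
    also have "\<dots> \<le> V * ((D * V / 2 ^ I) powr p' * \<Phi>)"
      using L(2) \<mu>_\<Phi> V by (intro mult_mono) auto
    finally show ?thesis by (simp add: mult.assoc)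
  qed
  have "(\<Sum>l\<in>L. T f l powr p') \<le> (\<Sum>l\<in>L. real (Suc I) powr p' * (\<Sum>i\<le>I. T (g i) l powr p'))"
  proof (rule sum_mono)
    fix l assume l: "l \<in> L"
    have "T f l powr p' \<le> (\<Sum>i\<le>I. T (g i) l) powr p'"
      using Tsub[OF l, of g] T0[OF l, of f] p'2 by (intro powr_mono2) (auto simp flip: f_eq)
    also have "\<dots> \<le> real (Suc I) powr p' * (\<Sum>i\<le>I. T (g i) l powr p')"
      using powr_sum_le[of "{..I}" "\<lambda>i. T (g i) l" p'] T0[OF l] p'2 by simp
    finally show "T f l powr p' \<le> real (Suc I) powr p' * (\<Sum>i\<le>I. T (g i) l powr p')" .
  qed
  also have "\<dots> = real (Suc I) powr p' * (\<Sum>i\<le>I. \<Sum>l\<in>L. T (g i) l powr p')"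
    by (subst sum.swap) (simp add: sum_distrib_left)
  also have "(\<Sum>i\<le>I. \<Sum>l\<in>L. T (g i) l powr p') = (\<Sum>i<I. \<Sum>l\<in>L. T (g i) l powr p') + (\<Sum>l\<in>L. T (g I) l powr p')"
    by (simp flip: lessThan_Suc_atMost)
  also have "real (Suc I) powr p' * \<dots> \<le> real (Suc I) powr p' * (real I * (X * \<Phi>) + V * (D * V / 2 ^ I) powr p' * \<Phi>)"
    using sum_bounded_above[of "{..<I}" "\<lambda>i. \<Sum>l\<in>L. T (g i) l powr p'" "X * \<Phi>"] level rest
    by (intro mult_left_mono add_mono) auto
  finally show ?thesis unfolding X_def \<Phi>_def by (simp add: algebra_simps)
qed

subsection \<open>The maximal function over a dyadic block\<close>

lemma lp_bounded_mono: "lp_bounded n p q T K \<Longrightarrow> K \<le> K' \<Longrightarrow> lp_bounded n p q T K'"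
  unfolding lp_bounded_def lp_norm_def by (meson mult_right_mono order_trans powr_ge_zero)

context
  fixes \<Gamma> :: "nat set" and \<Lambda> :: real
begin

abbreviation "dyadic_block \<equiv> {lam \<in> \<Gamma>. \<Lambda> \<le> real lam \<and> real lam < 2 * \<Lambda>}"

lemma finite_dyadic_block: "finite dyadic_block"
proof (rule finite_subset)
  show "dyadic_block \<subseteq> {..nat \<lceil>2 * \<Lambda>\<rceil>}" by (auto simp: le_nat_iff) linarith
qed simp

lemma le_dyadic_sup: "lam \<in> dyadic_block \<Longrightarrow> cmod (T lam f l) \<le> dyadic_sup \<Gamma> \<Lambda> T f l"
  unfolding dyadic_sup_def
  by (rule cSUP_upper) (auto intro!: bdd_above_finite finite_imageI finite_dyadic_block simp del: mem_Collect_eq)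

lemma dyadic_sup_le:
  "dyadic_block \<noteq> {} \<Longrightarrow> (\<And>lam. lam \<in> dyadic_block \<Longrightarrow> cmod (T lam f l) \<le> c) \<Longrightarrow> dyadic_sup \<Gamma> \<Lambda> T f l \<le> c"
  unfolding dyadic_sup_def by (rule cSUP_least)

lemma dyadic_sup_nonneg: "dyadic_block \<noteq> {} \<Longrightarrow> 0 \<le> dyadic_sup \<Gamma> \<Lambda> T f l"
  using le_dyadic_sup[of _ T f l] norm_ge_zero by (metis (no_types, lifting) all_not_in_conv order_trans)

text \<open>Feeds \<open>local_estimate\<close> into \<open>lp_localize\<close>. S bounds the
  kernels of the average and of the error at once, so it plays the part of both \<open>D\<close> and
  \<open>S\<close> in \<open>local_estimate\<close>.\<close>

lemma prime_avg_lp_bounded_block: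
  fixes W :: int and I :: nat and E :: "nat \<Rightarrow> ((nat \<Rightarrow> int) \<Rightarrow> complex) \<Rightarrow> (nat \<Rightarrow> int) \<Rightarrow> complex"
  assumes k: "k \<ge> 1" and ne: "dyadic_block \<noteq> {}"
    and p: "1 < p" "p < 2" "1 / p + 1 / p' = 1"
    and W: "W > 0" "2 * \<Lambda> \<le> real_of_int W ^ k" "(2 * real_of_int W) ^ n \<le> V"
    and nonneg: "0 \<le> D" "0 \<le> H" and S: "D + H \<le> S"
    and D: "\<And>lam x. lam \<in> dyadic_block \<Longrightarrow> cmod (prime_kernel n k lam x) \<le> D"
    and H: "\<And>lam x. lam \<in> dyadic_block \<Longrightarrow> cmod (M lam x) \<le> H"
    and E: "\<And>lam. E lam = convolve n (\<lambda>x. prime_kernel n k lam x - M lam x)"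
    and \<kappa>: "lp_bounded n 2 2 (dyadic_sup \<Gamma> \<Lambda> E) \<kappa>"
  shows "lp_bounded n p p' (dyadic_sup \<Gamma> \<Lambda> (prime_avg n k))
    ((real (Suc I) powr p' * (real I * (2 powr p' * (2 powr p' * S powr (p' - 2) * \<kappa>\<^sup>2 + V * (2 * H) powr p' * V))
       + V * (S * V / 2 ^ I) powr p') * (2 ^ n) powr (p' / p)) powr (1 / p'))"
    (is "lp_bounded n p p' ?T _")
proof (rule lp_localize[OF W(1)])
  note p' = conjugate_exponent[OF p]
  have S0: "0 \<le> S" using nonneg S by linarith
  have "0 \<le> (2 * real_of_int W) ^ n" using W by simp
  then have V: "0 \<le> V" using W(3) by linarith
  show "0 < p" "p \<le> p'" using p p' by auto
  show "0 \<le> real (Suc I) powr p' * (real I * (2 powr p' * (2 powr p' * S powr (p' - 2) * \<kappa>\<^sup>2 + V * (2 * H) powr p' * V))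
       + V * (S * V / 2 ^ I) powr p')"
    using V by simp
  \<comment> \<open>x_i^k \<le> lam < 2 \<Lambda> \<le> W^k: one cube serves the whole dyadic block,
    which gives the locality that \<open>lp_localize\<close> asks for.\<close>
  have cube: "prime_vecs n k lam \<subseteq> {..<n} \<rightarrow>\<^sub>E {0..<W}" if lam: "lam \<in> dyadic_block" for lam
  proof
    fix x assume x: "x \<in> prime_vecs n k lam"
    have "x i \<in> {0..<W}" if i: "i < n" for i
    proof -
      have "real_of_int (x i) ^ k \<le> real lam"
        using of_int_le_iff[where 'a = real, THEN iffD2, OF prime_vecs_coord(2)[OF k x i]] by simp
      also have "\<dots> < 2 * \<Lambda>" using lam by simp
      also have "\<dots> \<le> real_of_int W ^ k" by (rule W(2))
      finally have "real_of_int (x i) < real_of_int W"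
        by (rule power_less_imp_less_base) (use W(1) in simp)
      then show ?thesis using prime_vecs_coord(1)[OF k x i] by simp
    qed
    then show "x \<in> {..<n} \<rightarrow>\<^sub>E {0..<W}" using x by (auto simp: prime_vecs_def int_vecs_def PiE_iff)
  qed
  show "?T f l = ?T g l"
    if "\<And>x. x \<in> {..<n} \<rightarrow>\<^sub>E {0..<W} \<Longrightarrow> f (vec_diff n x l) = g (vec_diff n x l)" for f g l
    unfolding dyadic_sup_def
  proof (rule SUP_cong[OF refl])
    fix lam assume lam: "lam \<in> dyadic_block"
    have "prime_avg n k lam f l = prime_avg n k lam g l"
      unfolding prime_avg_eq_sum by (intro sum.cong refl arg_cong2[of _ _ _ _ "(*)"] that) (use cube[OF lam] in blast)
    then show "cmod (prime_avg n k lam f l) = cmod (prime_avg n k lam g l)" by simp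
  qed
  fix f :: "(nat \<Rightarrow> int) \<Rightarrow> complex" and Y L
  assume Y: "finite Y" "Y \<subseteq> int_vecs n" and f: "\<And>y. y \<notin> Y \<Longrightarrow> f y = 0"
    and cardY: "real (card Y) \<le> (2 * real_of_int W) ^ n" and L: "finite L" "L \<subseteq> int_vecs n"
    and cardL: "real (card L) \<le> (2 * real_of_int W) ^ n"
  \<comment> \<open>The error operator is a convolution and the average a correlation; so the former
    is always applied to functions composed with this reflection.\<close>
  define \<rho> where "\<rho> = vec_diff n (\<lambda>_. 0)"
  have \<rho>\<rho>: "\<rho> (\<rho> y) = y" if "y \<in> int_vecs n" for y
    unfolding \<rho>_def by (rule vec_diff_vec_diff[OF that])
  have reflect: "finite (\<rho> ` Y)" "\<rho> ` Y \<subseteq> int_vecs n"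
    using Y by (auto simp: \<rho>_def)
  have reflect0: "g (\<rho> y) = 0" if "\<And>y. y \<notin> Y \<Longrightarrow> g y = 0" "y \<in> int_vecs n - \<rho> ` Y"
    for g :: "(nat \<Rightarrow> int) \<Rightarrow> complex" and y
    using that \<rho>\<rho>[of y] by (metis DiffD1 DiffD2 imageI)
  have reflect_sum: "(\<Sum>y\<in>\<rho> ` Y. F (g (\<rho> y))) = (\<Sum>y\<in>Y. F (g y))"
    for F :: "complex \<Rightarrow> real" and g :: "(nat \<Rightarrow> int) \<Rightarrow> complex"
  proof -
    have "(\<Sum>y\<in>\<rho> ` Y. F (g (\<rho> y))) = (\<Sum>y\<in>Y. F (g (\<rho> (\<rho> y))))"
      unfolding \<rho>_def using Y by (simp add: sum.reindex inj_on_vec_diff)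
    also have "\<dots> = (\<Sum>y\<in>Y. F (g y))" using Y \<rho>\<rho> by (intro sum.cong) auto
    finally show ?thesis .
  qed
  have avg: "prime_avg n k lam g l = (\<Sum>y\<in>\<rho> ` Y. prime_kernel n k lam (vec_diff n l y) * g (\<rho> y))"
    if "\<And>y. y \<notin> Y \<Longrightarrow> g y = 0" for g lam l
    unfolding prime_avg_eq_convolve[OF k] \<rho>_def[symmetric]
    by (rule convolve_finite_support[OF reflect reflect0]) (use that in auto)
  have err: "E lam (\<lambda>y. g (\<rho> y)) l =
      (\<Sum>y\<in>\<rho> ` Y. (prime_kernel n k lam (vec_diff n l y) - M lam (vec_diff n l y)) * g (\<rho> y))"
    if "\<And>y. y \<notin> Y \<Longrightarrow> g y = 0" for g lam l
    unfolding E
    by (rule convolve_finite_support[OF reflect reflect0]) (use that in auto)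
  have kernel_le: "cmod (\<Sum>y\<in>\<rho> ` Y. K (vec_diff n l y) * g (\<rho> y)) \<le> c * (\<Sum>y\<in>Y. cmod (g y))"
    if "\<And>x. cmod (K x) \<le> c" for K :: "(nat \<Rightarrow> int) \<Rightarrow> complex" and g l c
  proof -
    have "cmod (\<Sum>y\<in>\<rho> ` Y. K (vec_diff n l y) * g (\<rho> y)) \<le> (\<Sum>y\<in>\<rho> ` Y. c * cmod (g (\<rho> y)))"
      by (intro order_trans[OF norm_sum] sum_mono) (simp add: norm_mult mult_right_mono that)
    also have "\<dots> = c * (\<Sum>y\<in>Y. cmod (g y))"
      using reflect_sum[of cmod g] by (simp flip: sum_distrib_left)
    finally show ?thesis .
  qed
  have T0: "0 \<le> ?T g l" for g l by (rule dyadic_sup_nonneg[OF ne])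
  have "(\<Sum>l\<in>L. ?T f l powr p') \<le>
    real (Suc I) powr p' * (real I * (2 powr p' * (2 powr p' * S powr (p' - 2) * \<kappa>\<^sup>2 + V * (2 * H) powr p' * V))
       + V * (S * V / 2 ^ I) powr p') * (\<Sum>y\<in>Y. cmod (f y) powr p) powr (p' / p)"
  proof (rule local_estimate[OF Y(1) _ L(1) _ p S0 nonneg(2) S0 _ T0])
    show "real (card Y) \<le> V" "real (card L) \<le> V" using cardY cardL W(3) by auto
    show "?T (\<lambda>y. \<Sum>i\<le>I. g i y) l \<le> (\<Sum>i\<le>I. ?T (g i) l)" for g l
    proof (rule dyadic_sup_le[OF ne])
      fix lam assume lam: "lam \<in> dyadic_block"
      have "prime_avg n k lam (\<lambda>y. \<Sum>i\<le>I. g i y) l = (\<Sum>i\<le>I. prime_avg n k lam (g i) l)"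
        unfolding prime_avg_eq_sum sum_distrib_left by (rule sum.swap)
      then show "cmod (prime_avg n k lam (\<lambda>y. \<Sum>i\<le>I. g i y) l) \<le> (\<Sum>i\<le>I. ?T (g i) l)"
        by (simp only:) (intro order_trans[OF norm_sum] sum_mono le_dyadic_sup lam)
    qed
    show "?T g l \<le> S * (\<Sum>y\<in>Y. cmod (g y))" if g: "\<And>y. y \<notin> Y \<Longrightarrow> g y = 0" for g l
    proof (rule dyadic_sup_le[OF ne])
      fix lam assume lam: "lam \<in> dyadic_block"
      show "cmod (prime_avg n k lam g l) \<le> S * (\<Sum>y\<in>Y. cmod (g y))"
      proof -
        have "cmod (prime_kernel n k lam x) \<le> S" for x
          using D[OF lam, of x] S nonneg by linarith
        then have "cmod (\<Sum>y\<in>\<rho> ` Y. prime_kernel n k lam (vec_diff n l y) * g (\<rho> y)) \<le> S * (\<Sum>y\<in>Y. cmod (g y))"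
          by (rule kernel_le)
        moreover have "prime_avg n k lam g l = (\<Sum>y\<in>\<rho> ` Y. prime_kernel n k lam (vec_diff n l y) * g (\<rho> y))"
          by (rule avg) (rule g)
        ultimately show ?thesis by (simp only:)
      qed
    qed
    show "\<exists>u. (\<forall>l\<in>L. 0 \<le> u l \<and> u l \<le> S * (\<Sum>y\<in>Y. cmod (g y)) \<and> ?T g l \<le> u l + H * (\<Sum>y\<in>Y. cmod (g y)))
        \<and> (\<Sum>l\<in>L. (u l)\<^sup>2) \<le> \<kappa>\<^sup>2 * (\<Sum>y\<in>Y. (cmod (g y))\<^sup>2)"
      if g: "\<And>y. y \<notin> Y \<Longrightarrow> g y = 0" for g
    \<comment> \<open>The witness is the maximal error function of the reflected g. The average is
      error plus main term, and the latter adds at most H times the \<ell>^1 norm, uniformly over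
      the block.\<close>
    proof (intro exI[of _ "dyadic_sup \<Gamma> \<Lambda> E (\<lambda>y. g (\<rho> y))"] conjI ballI)
      fix l
      show "0 \<le> dyadic_sup \<Gamma> \<Lambda> E (\<lambda>y. g (\<rho> y)) l" by (rule dyadic_sup_nonneg[OF ne])
      show "dyadic_sup \<Gamma> \<Lambda> E (\<lambda>y. g (\<rho> y)) l \<le> S * (\<Sum>y\<in>Y. cmod (g y))"
      proof (rule dyadic_sup_le[OF ne])
        fix lam assume lam: "lam \<in> dyadic_block"
        have "cmod (prime_kernel n k lam x - M lam x) \<le> S" for x
          using norm_triangle_ineq4[of "prime_kernel n k lam x" "M lam x"] D[OF lam, of x] H[OF lam, of x] S
          by linarith
        then have "cmod (\<Sum>y\<in>\<rho> ` Y. (prime_kernel n k lam (vec_diff n l y) - M lam (vec_diff n l y)) * g (\<rho> y))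
            \<le> S * (\<Sum>y\<in>Y. cmod (g y))"
          by (rule kernel_le[where K = "\<lambda>x. prime_kernel n k lam x - M lam x"])
        moreover have "E lam (\<lambda>y. g (\<rho> y)) l =
            (\<Sum>y\<in>\<rho> ` Y. (prime_kernel n k lam (vec_diff n l y) - M lam (vec_diff n l y)) * g (\<rho> y))"
          by (rule err) (rule g)
        ultimately show "cmod (E lam (\<lambda>y. g (\<rho> y)) l) \<le> S * (\<Sum>y\<in>Y. cmod (g y))"
          by (simp only:)
      qed
      show "?T g l \<le> dyadic_sup \<Gamma> \<Lambda> E (\<lambda>y. g (\<rho> y)) l + H * (\<Sum>y\<in>Y. cmod (g y))"
      proof (rule dyadic_sup_le[OF ne])
        fix lam assume lam: "lam \<in> dyadic_block"
        have "prime_avg n k lam g l = E lam (\<lambda>y. g (\<rho> y)) l + (\<Sum>y\<in>\<rho> ` Y. M lam (vec_diff n l y) * g (\<rho> y))"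
        proof -
          have "prime_avg n k lam g l = (\<Sum>y\<in>\<rho> ` Y. prime_kernel n k lam (vec_diff n l y) * g (\<rho> y))"
            by (rule avg) (rule g)
          moreover have "E lam (\<lambda>y. g (\<rho> y)) l =
              (\<Sum>y\<in>\<rho> ` Y. (prime_kernel n k lam (vec_diff n l y) - M lam (vec_diff n l y)) * g (\<rho> y))"
            by (rule err) (rule g)
          ultimately show ?thesis by (simp add: algebra_simps flip: sum.distrib)
        qed
        then show "cmod (prime_avg n k lam g l) \<le> dyadic_sup \<Gamma> \<Lambda> E (\<lambda>y. g (\<rho> y)) l + H * (\<Sum>y\<in>Y. cmod (g y))"
          by (simp only:) (use norm_triangle_ineq[of "E lam (\<lambda>y. g (\<rho> y)) l" "\<Sum>y\<in>\<rho> ` Y. M lam (vec_diff n l y) * g (\<rho> y)"]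
            le_dyadic_sup[OF lam, of E "\<lambda>y. g (\<rho> y)" l] kernel_le[where K = "M lam" and g = g and l = l, OF H[OF lam]] in linarith)
      qed
    next
      have "(\<Sum>l\<in>L. (dyadic_sup \<Gamma> \<Lambda> E (\<lambda>y. g (\<rho> y)) l)\<^sup>2) \<le> \<kappa>\<^sup>2 * (\<Sum>y\<in>\<rho> ` Y. (cmod (g (\<rho> y)))\<^sup>2)"
        by (rule lp_bounded_2_finite_support[OF \<kappa> reflect reflect0 L]) (use g in auto)
      then show "(\<Sum>l\<in>L. (dyadic_sup \<Gamma> \<Lambda> E (\<lambda>y. g (\<rho> y)) l)\<^sup>2) \<le> \<kappa>\<^sup>2 * (\<Sum>y\<in>Y. (cmod (g y))\<^sup>2)"
        by (simp add: reflect_sum[of "\<lambda>z. (cmod z)\<^sup>2"])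
    qed
  qed (use f in auto)
  then show "(\<Sum>l\<in>L. \<bar>?T f l\<bar> powr p') \<le>
    real (Suc I) powr p' * (real I * (2 powr p' * (2 powr p' * S powr (p' - 2) * \<kappa>\<^sup>2 + V * (2 * H) powr p' * V))
       + V * (S * V / 2 ^ I) powr p') * (\<Sum>y\<in>Y. cmod (f y) powr p) powr (p' / p)"
    using T0 by (simp add: abs_of_nonneg)
qed

end

section \<open>Balance of the powers of \<open>\<Lambda>\<close> and
  \<open>ln \<Lambda>\<close>\<close>

lemma eventually_ln_powr_le_powr:
  fixes a b c :: real
  assumes "b > 0" shows "\<forall>\<^sub>F x in at_top. c * ln x powr a \<le> x powr b"
proof -
  have "((\<lambda>x. ln x powr a / x powr b) \<longlongrightarrow> 0) at_top"
    using assms by real_asymp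
  then have "((\<lambda>x. c * (ln x powr a / x powr b)) \<longlongrightarrow> c * 0) at_top"
    by (rule tendsto_mult_left)
  then have "\<forall>\<^sub>F x in at_top. c * (ln x powr a / x powr b) < 1"
    by (rule order_tendstoD) simp
  with eventually_gt_at_top[of 0] show ?thesis
    by eventually_elim (simp add: field_simps)
qed

text \<open>Here s stands for n/k, and G is the p'-th power of the target, since (p' - 2)/p' = 2/p -
  1. The levels contribute up to l^(p'+1). For the error part \<beta> is solved so that the
  logarithms match G exactly; the main term falls below G by \<Lambda>^(-(p'-2)), and the last level
  by \<Lambda>^(-1) through the choice of A. Those spare powers absorb logarithms, as the two
  hypotheses \<open>large\<close> express.\<close>

lemma scale_arithmetic:
  fixes \<Lambda> s A B \<beta> cS cH K p' h n' :: real and n :: nat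
  defines "l \<equiv> ln \<Lambda>"
  defines "G \<equiv> \<Lambda> powr ((1 - s) * (p' - 2)) * l powr (- (B * p'))"
  assumes \<Lambda>: "1 < \<Lambda>" "1 \<le> l" and p': "2 < p'" and nonneg: "0 \<le> cS" "0 \<le> cH" "0 \<le> A"
    and \<beta>: "2 * \<beta> = p' + 1 + n' * (p' - 2) + B * p'"
    and A: "A / 2 * p' = 1 - (1 - s) * (p' - 2) + s + p'"
    and I: "A * l \<le> real I" "real (Suc I) \<le> (A + 2) * l"
    and S: "S = cS * l powr n' * \<Lambda> powr (1 - s)"
    and H: "H = cH * l powr h * \<Lambda> powr (- s)"
    and V: "V = 6 ^ n * \<Lambda> powr s"
    and \<kappa>: "\<kappa> = K * l powr (- \<beta>)"
    and large: "l powr (p' + 1 + h * p' + B * p') \<le> \<Lambda> powr (p' - 2)"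
      "l powr (p' + n' * p' + B * p') \<le> \<Lambda> powr 1"
  shows "real (Suc I) powr p' * (real I * (2 powr p' * (2 powr p' * S powr (p' - 2) * \<kappa>\<^sup>2 + V * (2 * H) powr p' * V))
       + V * (S * V / 2 ^ I) powr p') \<le>
    (A + 2) powr p' * ((A + 2) * (2 powr p' * (2 powr p' * (cS powr (p' - 2) * K\<^sup>2) + 36 ^ n * (2 * cH) powr p'))
       + 6 ^ n * (cS * 6 ^ n) powr p') * G"
proof -
  have l: "0 < l" "0 < \<Lambda>" using \<Lambda> by auto
  have G0: "0 \<le> G" by (simp add: G_def)
  define x1 where "x1 = S powr (p' - 2) * \<kappa>\<^sup>2"
  define x2 where "x2 = V * (2 * H) powr p' * V"
  define x3 where "x3 = V * (S * V / 2 ^ I) powr p'"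
  have V0: "0 \<le> V" by (simp add: V)
  have x0: "0 \<le> x1" "0 \<le> x2" "0 \<le> x3" using V0 by (auto simp: x1_def x2_def x3_def)
  have F1: "l powr (p' + 1) * x1 = cS powr (p' - 2) * K\<^sup>2 * G"
  proof -
    have "S powr (p' - 2) = cS powr (p' - 2) * l powr (n' * (p' - 2)) * \<Lambda> powr ((1 - s) * (p' - 2))"
      unfolding S using nonneg by (simp add: powr_mult powr_powr)
    moreover have "\<kappa>\<^sup>2 = K\<^sup>2 * l powr (- (2 * \<beta>))"
      unfolding \<kappa> power_mult_distrib using l by (simp add: power2_eq_square flip: powr_add)
    ultimately have "l powr (p' + 1) * x1 = cS powr (p' - 2) * K\<^sup>2 * \<Lambda> powr ((1 - s) * (p' - 2)) *
        (l powr (p' + 1) * l powr (n' * (p' - 2)) * l powr (- (2 * \<beta>)))"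
      by (simp add: x1_def mult_ac)
    also have "l powr (p' + 1) * l powr (n' * (p' - 2)) * l powr (- (2 * \<beta>)) = l powr (- (B * p'))"
      unfolding \<beta> powr_add[symmetric] by simp
    finally show ?thesis by (simp add: G_def mult_ac)
  qed
  have F2: "l powr (p' + 1) * x2 \<le> 36 ^ n * (2 * cH) powr p' * G"
  proof -
    have "(2 * H) powr p' = (2 * cH) powr p' * l powr (h * p') * \<Lambda> powr (- s * p')"
      unfolding H using nonneg by (simp add: powr_mult powr_powr)
    moreover have "V * V = 36 ^ n * \<Lambda> powr (2 * s)"
    proof -
      have "V * V = (6 * 6) ^ n * (\<Lambda> powr s * \<Lambda> powr s)"
        unfolding V power_mult_distrib by (simp only: mult_ac)
      then show ?thesis by (simp flip: powr_add)
    qed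
    ultimately have "l powr (p' + 1) * x2 = 36 ^ n * (2 * cH) powr p' *
        ((l powr (p' + 1) * l powr (h * p')) * (\<Lambda> powr (2 * s) * \<Lambda> powr (- s * p')))"
      by (simp add: x2_def mult_ac)
    also have "l powr (p' + 1) * l powr (h * p') = l powr (p' + 1 + h * p' + B * p') * l powr (- (B * p'))"
      unfolding powr_add[symmetric] by simp
    \<comment> \<open>2s - s p' = (1 - s)(p' - 2) - (p' - 2): this is where the main term beats the
      target.\<close>
    also have "\<Lambda> powr (2 * s) * \<Lambda> powr (- s * p') = \<Lambda> powr (- (p' - 2)) * \<Lambda> powr ((1 - s) * (p' - 2))"
      unfolding powr_add[symmetric] by (simp add: algebra_simps)
    also have "l powr (p' + 1 + h * p' + B * p') * l powr (- (B * p')) * (\<Lambda> powr (- (p' - 2)) * \<Lambda> powr ((1 - s) * (p' - 2)))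
        = (l powr (p' + 1 + h * p' + B * p') * \<Lambda> powr (- (p' - 2))) * G"
      by (simp only: G_def mult_ac)
    also have "\<dots> \<le> 1 * G"
    proof (rule mult_right_mono[OF _ G0])
      have "l powr (p' + 1 + h * p' + B * p') * \<Lambda> powr (- (p' - 2)) \<le> \<Lambda> powr (p' - 2) * \<Lambda> powr (- (p' - 2))"
        by (rule mult_right_mono[OF large(1)]) simp
      then show "l powr (p' + 1 + h * p' + B * p') * \<Lambda> powr (- (p' - 2)) \<le> 1"
        using l by (simp flip: powr_add)
    qed
    finally show ?thesis using nonneg by (simp add: mult_left_mono)
  qed
  have F3: "l powr p' * x3 \<le> 6 ^ n * (cS * 6 ^ n) powr p' * G"
  proof -
    \<comment> \<open>A l levels give 2^I \<ge> exp (A l ln 2), and the crude ln 2 \<ge> 1/2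
      explains the A/2 in the equation for A.\<close>
    have "\<Lambda> powr (A / 2) = exp (A * l / 2)" using l by (simp add: powr_def l_def)
    also have "\<dots> \<le> exp (real I * ln 2)"
    proof -
      have "A * l / 2 \<le> real I * (1 / 2)" using I(1) by simp
      also have "\<dots> \<le> real I * ln 2" using ln2_ge_two_thirds by (intro mult_left_mono) auto
      finally show ?thesis by simp
    qed
    also have "\<dots> = 2 ^ I" by (simp add: exp_of_nat_mult)
    finally have "S * V / 2 ^ I \<le> S * V / \<Lambda> powr (A / 2)"
      using l nonneg V0 by (intro divide_left_mono) (auto simp: S)
    then have "(S * V / 2 ^ I) powr p' \<le> (S * V / \<Lambda> powr (A / 2)) powr p'"
      using p' nonneg V0 by (intro powr_mono2) (auto simp: S)
    also have "S * V / \<Lambda> powr (A / 2) = (cS * 6 ^ n) * l powr n' * \<Lambda> powr (1 - A / 2)"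
      unfolding S V using l by (simp add: powr_diff)
    also have "\<dots> powr p' = (cS * 6 ^ n) powr p' * l powr (n' * p') * \<Lambda> powr (p' - A / 2 * p')"
      using nonneg by (simp add: powr_mult powr_powr algebra_simps)
    finally have "l powr p' * x3 \<le> l powr p' * (V * ((cS * 6 ^ n) powr p' * l powr (n' * p') * \<Lambda> powr (p' - A / 2 * p')))"
      unfolding x3_def using V0 by (intro mult_left_mono) auto
    also have "\<dots> = 6 ^ n * (cS * 6 ^ n) powr p' *
        ((l powr p' * l powr (n' * p')) * (\<Lambda> powr s * \<Lambda> powr (p' - A / 2 * p')))"
      by (simp only: V mult_ac)
    also have "l powr p' * l powr (n' * p') = l powr (p' + n' * p' + B * p') * l powr (- (B * p'))"
      unfolding powr_add[symmetric] by simp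
    also have "\<Lambda> powr s * \<Lambda> powr (p' - A / 2 * p') = \<Lambda> powr (- 1) * \<Lambda> powr ((1 - s) * (p' - 2))"
      unfolding powr_add[symmetric] A by simp
    also have "l powr (p' + n' * p' + B * p') * l powr (- (B * p')) * (\<Lambda> powr (- 1) * \<Lambda> powr ((1 - s) * (p' - 2)))
        = (l powr (p' + n' * p' + B * p') * \<Lambda> powr (- 1)) * G"
      by (simp only: G_def mult_ac)
    also have "6 ^ n * (cS * 6 ^ n) powr p' * \<dots> \<le> 6 ^ n * (cS * 6 ^ n) powr p' * (1 * G)"
    proof (intro mult_left_mono mult_right_mono G0)
      have "l powr (p' + n' * p' + B * p') * \<Lambda> powr (- 1) \<le> \<Lambda> powr 1 * \<Lambda> powr (- 1)"
        by (rule mult_right_mono[OF large(2)]) simp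
      then show "l powr (p' + n' * p' + B * p') * \<Lambda> powr (- 1) \<le> 1"
        using l by (simp only: powr_add[symmetric]) simp
    qed (use nonneg in auto)
    finally show ?thesis by simp
  qed
  have "real (Suc I) powr p' * (real I * (2 powr p' * (2 powr p' * x1 + x2)) + x3) \<le>
      ((A + 2) * l) powr p' * (((A + 2) * l) * (2 powr p' * (2 powr p' * x1 + x2)) + x3)"
    using I p' x0 nonneg by (intro mult_mono add_mono mult_right_mono powr_mono2) auto
  also have "\<dots> = (A + 2) powr p' * ((A + 2) * (2 powr p' * (2 powr p' * (l powr (p' + 1) * x1) + l powr (p' + 1) * x2))
      + l powr p' * x3)"
  proof -
    have "((A + 2) * l) powr p' = (A + 2) powr p' * l powr p'" "l powr (p' + 1) = l powr p' * l"
      using nonneg l by (simp_all add: powr_mult powr_add)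
    then show ?thesis by (simp only:) (simp add: algebra_simps)
  qed
  also have "\<dots> \<le> (A + 2) powr p' * ((A + 2) * (2 powr p' * (2 powr p' * (cS powr (p' - 2) * K\<^sup>2 * G) + 36 ^ n * (2 * cH) powr p' * G))
      + 6 ^ n * (cS * 6 ^ n) powr p' * G)"
    using F1 F2 F3 nonneg by (intro mult_left_mono add_mono) auto
  also have "\<dots> = (A + 2) powr p' * ((A + 2) * (2 powr p' * (2 powr p' * (cS powr (p' - 2) * K\<^sup>2) + 36 ^ n * (2 * cH) powr p'))
       + 6 ^ n * (cS * 6 ^ n) powr p') * G"
    by (simp add: algebra_simps)
  finally show ?thesis by (simp add: x1_def x2_def x3_def mult.assoc)
qed

section \<open>Consequences of Hua's asymptotic along the progression\<close>

lemma hua_progression_lower_bound: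
  assumes "hua_progression n k \<Gamma>"
  obtains c L where "0 < c" "\<And>lam. lam \<in> \<Gamma> \<Longrightarrow> L \<le> lam \<Longrightarrow> c * real lam powr (real n / real k - 1) \<le> prime_count n k lam"
proof -
  obtain S :: "nat \<Rightarrow> real" and c1 c2 where c: "0 < c1" "\<And>lam. lam \<in> \<Gamma> \<Longrightarrow> c1 \<le> S lam \<and> S lam \<le> c2"
    and equiv: "prime_count n k \<sim>[inf at_top (principal \<Gamma>)] (\<lambda>lam. S lam * real lam powr (real n / real k - 1))"
    using assms unfolding hua_progression_def by blast
  define g where "g lam = S lam * real lam powr (real n / real k - 1)" for lam
  have "\<forall>\<^sub>F lam in inf at_top (principal \<Gamma>).
      (if prime_count n k lam = 0 \<and> g lam = 0 then 1 else prime_count n k lam / g lam) > 1 / 2"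
    using equiv unfolding asymp_equiv_def g_def[symmetric] by (rule order_tendstoD) simp
  then obtain L where L: "\<And>lam. L \<le> lam \<Longrightarrow> lam \<in> \<Gamma> \<Longrightarrow>
      (if prime_count n k lam = 0 \<and> g lam = 0 then 1 else prime_count n k lam / g lam) > 1 / 2"
    unfolding eventually_inf_principal eventually_at_top_linorder by blast
  show ?thesis
  proof
    \<comment> \<open>From L on the quotient by the asymptotic exceeds 1/2, and \<open>S lam\<close>
      is at least c1. The 1 in \<open>max 1 L\<close> keeps lam positive, so the convention for 0/0
      in \<open>asymp_equiv\<close> does not intervene.\<close>
    show "0 < c1 / 2" using c(1) by simp
    fix lam assume lam: "lam \<in> \<Gamma>" "max 1 L \<le> lam"
    then have pos: "0 < real lam powr (real n / real k - 1)" by simp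
    have "c1 * real lam powr (real n / real k - 1) \<le> g lam"
      unfolding g_def using c(2)[OF lam(1)] by (intro mult_right_mono) auto
    moreover have g: "0 < g lam" unfolding g_def using c(1) c(2)[OF lam(1)] pos by (intro mult_pos_pos) auto
    moreover have "prime_count n k lam / g lam > 1 / 2" using L[of lam] lam g by auto
    ultimately show "c1 / 2 * real lam powr (real n / real k - 1) \<le> prime_count n k lam"
      by (simp add: field_simps)
  qed
qed

text \<open>For large \<Lambda> the interval [\<Lambda>, 2 \<Lambda>) is longer than the common
  difference. A supremum over an empty block would be a meaningless default value.\<close>

lemma eventually_dyadic_block_nonempty:
  assumes "hua_progression n k \<Gamma>"
  shows "\<forall>\<^sub>F \<Lambda> in at_top. {lam \<in> \<Gamma>. \<Lambda> \<le> real lam \<and> real lam < 2 * \<Lambda>} \<noteq> {}"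
proof -
  obtain a d where d: "d > 0" "\<Gamma> = {a + d * m | m. True}"
    using assms unfolding hua_progression_def by blast
  show ?thesis
    using eventually_ge_at_top[of "real (a + d + 1)"]
  proof eventually_elim
    fix \<Lambda> assume \<Lambda>: "real (a + d + 1) \<le> \<Lambda>"
    define m where "m = nat \<lceil>(\<Lambda> - real a) / real d\<rceil>"
    have "0 \<le> (\<Lambda> - real a) / real d" using \<Lambda> by simp
    then have "(\<Lambda> - real a) / real d \<le> real m" "real m < (\<Lambda> - real a) / real d + 1"
      unfolding m_def by linarith+
    then have "\<Lambda> - real a \<le> real d * real m" "real d * real m < \<Lambda> - real a + real d"
      using d(1) by (simp_all add: field_simps)
    then have "a + d * m \<in> {lam \<in> \<Gamma>. \<Lambda> \<le> real lam \<and> real lam < 2 * \<Lambda>}"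
      using \<Lambda> d(2) by auto
    then show "{lam \<in> \<Gamma>. \<Lambda> \<le> real lam \<and> real lam < 2 * \<Lambda>} \<noteq> {}" by blast
  qed
qed

lemma log_weight_le:
  assumes "k \<ge> 1" "x \<in> prime_vecs n k lam"
  shows "log_weight n x \<le> ln (real lam) ^ n"
proof -
  have "(\<Prod>i<n. ln (real_of_int (x i))) \<le> (\<Prod>i<n. ln (real lam))"
  proof (intro prod_mono conjI)
    fix i assume "i \<in> {..<n}"
    then have x: "2 \<le> x i" "x i \<le> int lam" using prime_vecs_coord[OF assms] by auto
    then show "0 \<le> ln (real_of_int (x i))" by simp
    have "real_of_int (x i) \<le> real_of_int (int lam)" using x(2) by (simp only: of_int_le_iff)
    then show "ln (real_of_int (x i)) \<le> ln (real lam)" using x(1) by (intro ln_mono) auto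
  qed
  then show ?thesis by (simp add: log_weight_def)
qed

text \<open>Fixes all parameters so that the block estimate and \<open>scale_arithmetic\<close> fit
  together. The sign of C is recorded for a later comparison of two powers of
  \<open>ln \<Lambda>\<close> under the same constant.\<close>

lemma prime_avg_dyadic_bound:
  assumes k: "k \<ge> 2" and hua: "hua_progression n k \<Gamma>" and \<psi>: "cutoff_fun n \<psi>"
    and N: "admissible_scale k N"
    and err: "\<And>B. B > 0 \<Longrightarrow> \<exists>C>0. \<exists>K. \<forall>\<^sub>F \<Lambda> in at_top.
        lp_bounded n 2 2 (dyadic_sup \<Gamma> \<Lambda> (error_op n k \<psi> (N \<Lambda>) (ln (N \<Lambda>) powr C))) (K * ln \<Lambda> powr (- B))"
    and p: "1 < p" "p < 2" "1 / p + 1 / p' = 1" and B: "B > 0"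
  shows "\<exists>C\<ge>0. \<forall>\<^sub>F \<Lambda> in at_top. lp_bounded n p p' (dyadic_sup \<Gamma> \<Lambda> (prime_avg n k))
                (C * \<Lambda> powr ((1 - real n / real k) * (2 / p - 1)) * ln \<Lambda> powr (- B))"
proof -
  note p' = conjugate_exponent(2)[OF p]
  define s where "s = real n / real k"
  have s0: "0 \<le> s" by (simp add: s_def)
  \<comment> \<open>The exponent requested from the \<ell>^2 hypothesis: p' + 1 pays for the levels,
    n (p' - 2) for the logarithms in the kernel bound S, B p' for the gain wanted; halved because
    \<kappa> enters squared.\<close>
  define B1 where "B1 = (p' + 1 + real n * (p' - 2) + B * p') / 2"
  have B1: "0 < B1" "2 * B1 = p' + 1 + real n * (p' - 2) + B * p'"
    using p' B by (auto simp: B1_def intro!: add_pos_nonneg mult_nonneg_nonneg)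
  obtain C K where C: "C > 0" and EK: "\<forall>\<^sub>F \<Lambda> in at_top.
        lp_bounded n 2 2 (dyadic_sup \<Gamma> \<Lambda> (error_op n k \<psi> (N \<Lambda>) (ln (N \<Lambda>) powr C))) (K * ln \<Lambda> powr (- B1))"
    using err[OF B1(1)] by blast
  obtain c0 L0 where c0: "0 < c0"
    and pc: "\<And>lam. lam \<in> \<Gamma> \<Longrightarrow> L0 \<le> lam \<Longrightarrow> c0 * real lam powr (s - 1) \<le> prime_count n k lam"
    using hua_progression_lower_bound[OF hua] unfolding s_def by metis
  obtain cN where evN: "\<forall>\<^sub>F \<Lambda> in at_top. \<forall>lam::real. \<Lambda> \<le> lam \<and> lam < 2 * \<Lambda> \<longrightarrow>
        lam powr (1 / real k) \<le> N \<Lambda> \<and> N \<Lambda> \<le> cN * lam powr (1 / real k)"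
    using N unfolding admissible_scale_def by blast
  \<comment> \<open>Solved from the equation in \<open>scale_arithmetic\<close> that makes the last
    level smaller than the target by \<Lambda>^(-1), up to logarithms.\<close>
  define A where "A = 2 * (1 - (1 - s) * (p' - 2) + s + p') / p'"
  have A: "0 \<le> A" "A / 2 * p' = 1 - (1 - s) * (p' - 2) + s + p'"
  proof -
    have "(1 - s) * (p' - 2) \<le> 1 * (p' - 2)" using s0 p' by (intro mult_right_mono) auto
    moreover have "0 \<le> 1 - t + s + p'" if "t \<le> 1 * (p' - 2)" for t
      using that s0 p' by simp
    ultimately have "0 \<le> 1 - (1 - s) * (p' - 2) + s + p'" by blast
    then show "0 \<le> A" unfolding A_def using p' by (intro divide_nonneg_pos mult_nonneg_nonneg) auto
    show "A / 2 * p' = 1 - (1 - s) * (p' - 2) + s + p'" using p' by (simp add: A_def)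
  qed
  \<comment> \<open>(Q^2/N)^n with Q \<le> l^C yields l^(2 C n); the constant cH is that of
    \<open>main_kernel_bound\<close>.\<close>
  define h where "h = 2 * C * real n"
  define cH where "cH = 2 * (32 * pi) ^ n"
  \<comment> \<open>s - 1 may have either sign: over the block, (lam/\<Lambda>)^(s-1) is at least 1
    or at least 2^(s-1).\<close>
  define m where "m = min 1 (2 powr (s - 1))"
  have m: "0 < m" by (simp add: m_def)
  define cD where "cD = 2 ^ n / (c0 * m)"
  have cD: "0 \<le> cD" using c0 m by (simp add: cD_def)
  define C0 where "C0 = (A + 2) powr p' * ((A + 2) * (2 powr p' * (2 powr p' * ((cD + 1) powr (p' - 2) * K\<^sup>2) + 36 ^ n * (2 * cH) powr p'))
       + 6 ^ n * ((cD + 1) * 6 ^ n) powr p')"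
  define CC where "CC = (C0 * (2 ^ n) powr (p' / p)) powr (1 / p')"
  \<comment> \<open>Makes each single error operator a contraction on \<ell>^2, which is the premise
    \<open>E\<close> of \<open>main_kernel_bound\<close>.\<close>
  have small: "\<forall>\<^sub>F \<Lambda> in at_top. (K * ln \<Lambda> powr (- B1))\<^sup>2 \<le> 1"
  proof -
    have "((\<lambda>x. ln x powr (- B1)) \<longlongrightarrow> 0) at_top" using B1(1) by real_asymp
    then have "((\<lambda>x. (K * ln x powr (- B1))\<^sup>2) \<longlongrightarrow> (K * 0)\<^sup>2) at_top"
      by (intro tendsto_intros)
    then have "\<forall>\<^sub>F \<Lambda> in at_top. (K * ln \<Lambda> powr (- B1))\<^sup>2 < 1" by (rule order_tendstoD) simp
    then show ?thesis by (rule eventually_mono) simp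
  qed
  \<comment> \<open>With 1/k \<le> 1/2 this gives N \<le> cN \<Lambda>^(1/k) \<le> \<Lambda>, so ln
    N \<le> ln \<Lambda> and Q is bounded by a power of ln \<Lambda>.\<close>
  have largeN: "\<forall>\<^sub>F \<Lambda> in at_top. cN * ln \<Lambda> powr 0 \<le> \<Lambda> powr (1 / 2)"
    by (rule eventually_ln_powr_le_powr) simp
  have large1: "\<forall>\<^sub>F \<Lambda> in at_top. 1 * ln \<Lambda> powr (p' + 1 + h * p' + B * p') \<le> \<Lambda> powr (p' - 2)"
    by (rule eventually_ln_powr_le_powr) (use p' in simp)
  have large2: "\<forall>\<^sub>F \<Lambda> in at_top. 1 * ln \<Lambda> powr (p' + real n * p' + B * p') \<le> \<Lambda> powr 1"
    by (rule eventually_ln_powr_le_powr) simp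
  have largeH: "\<forall>\<^sub>F \<Lambda> in at_top. cH * ln \<Lambda> powr h \<le> \<Lambda> powr 1"
    by (rule eventually_ln_powr_le_powr) simp
  have "\<forall>\<^sub>F \<Lambda> in at_top. lp_bounded n p p' (dyadic_sup \<Gamma> \<Lambda> (prime_avg n k))
                (CC * \<Lambda> powr ((1 - s) * (2 / p - 1)) * ln \<Lambda> powr (- B))"
    using eventually_dyadic_block_nonempty[OF hua] EK evN small largeN large1 large2 largeH
      eventually_ge_at_top[of "real (max L0 1)"] eventually_ge_at_top[of "exp 1"]
  proof eventually_elim
    case (elim \<Lambda>)
    note ne = elim(1)
    define l where "l = ln \<Lambda>"
    have \<Lambda>2: "2 \<le> \<Lambda>" using elim(10) exp_ge_add_one_self[of "1::real"] by linarith
    have "ln (exp 1) \<le> ln \<Lambda>" using elim(10) \<Lambda>2 by (intro ln_mono) auto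
    then have l1: "1 \<le> l" by (simp add: l_def)
    define \<kappa> where "\<kappa> = K * l powr (- B1)"
    define Q where "Q = ln (N \<Lambda>) powr C"
    have N1: "\<Lambda> powr (1 / real k) \<le> N \<Lambda>" "N \<Lambda> \<le> cN * \<Lambda> powr (1 / real k)"
      using elim(3)[rule_format, of \<Lambda>] \<Lambda>2 by auto
    have root1: "1 < \<Lambda> powr (1 / real k)" using \<Lambda>2 k powr_less_mono[of 0 "1 / real k" \<Lambda>] by simp
    then have N_gt: "1 < N \<Lambda>" using N1 by linarith
    have N_le: "N \<Lambda> \<le> \<Lambda>"
    proof -
      have "cN * \<Lambda> powr (1 / real k) \<le> \<Lambda> powr (1 / 2) * \<Lambda> powr (1 / 2)"
      proof (intro mult_mono)
        show "cN \<le> \<Lambda> powr (1 / 2)" using elim(5) l1 by (simp add: l_def)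
        show "\<Lambda> powr (1 / real k) \<le> \<Lambda> powr (1 / 2)" using \<Lambda>2 k by (intro powr_mono) (auto simp: field_simps)
      qed auto
      also have "\<dots> = \<Lambda>" using \<Lambda>2 by (simp flip: powr_add)
      finally show ?thesis using N1 by linarith
    qed
    have lnN: "0 < ln (N \<Lambda>)" "ln (N \<Lambda>) \<le> l"
      using N_gt N_le by (auto simp: l_def intro!: ln_mono)
    have Q: "0 < Q" "Q \<le> l powr C"
      unfolding Q_def using lnN C by (auto intro!: powr_mono2)
    have lp: "lp_bounded n 2 2 (dyadic_sup \<Gamma> \<Lambda> (error_op n k \<psi> (N \<Lambda>) Q)) \<kappa>"
      using elim(2) by (simp add: Q_def \<kappa>_def l_def)
    have \<kappa>1: "\<kappa>\<^sup>2 \<le> 1" using elim(4) by (simp add: \<kappa>_def l_def)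
    define H where "H = cH * l powr h * \<Lambda> powr (- s)"
    define D where "D = cD * l powr real n * \<Lambda> powr (1 - s)"
    \<comment> \<open>The added 1 makes room for H, which is at most \<Lambda>^(1-s) for large
      \<Lambda>.\<close>
    define S where "S = (cD + 1) * l powr real n * \<Lambda> powr (1 - s)"
    define V where "V = 6 ^ n * \<Lambda> powr s"
    define I where "I = nat \<lceil>A * l\<rceil>"
    define W where "W = \<lceil>(2 * \<Lambda>) powr (1 / real k)\<rceil>"
    have pcl: "0 < prime_count n k lam" "c0 * m * \<Lambda> powr (s - 1) \<le> prime_count n k lam"
      if lam: "lam \<in> \<Gamma>" "\<Lambda> \<le> real lam" "real lam < 2 * \<Lambda>" for lam
    proof -
      have "L0 \<le> lam" using lam(2) elim(9) by linarith
      then have *: "c0 * real lam powr (s - 1) \<le> prime_count n k lam" by (rule pc[OF lam(1)])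
      have "m \<le> (real lam / \<Lambda>) powr (s - 1)"
      proof (cases "s \<ge> 1")
        case True
        then have "1 \<le> (real lam / \<Lambda>) powr (s - 1)" using lam \<Lambda>2 by (intro ge_one_powr_ge_zero) auto
        then show ?thesis by (simp add: m_def)
      next
        case False
        then have "2 powr (s - 1) \<le> (real lam / \<Lambda>) powr (s - 1)"
          using lam \<Lambda>2 by (intro powr_mono2') (auto simp: field_simps)
        then show ?thesis by (simp add: m_def)
      qed
      then have "m * \<Lambda> powr (s - 1) \<le> (real lam / \<Lambda>) powr (s - 1) * \<Lambda> powr (s - 1)" by (rule mult_right_mono) simp
      also have "\<dots> = real lam powr (s - 1)" using \<Lambda>2 by (simp add: powr_divide)
      finally have "c0 * (m * \<Lambda> powr (s - 1)) \<le> c0 * real lam powr (s - 1)" using c0 by (intro mult_left_mono) auto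
      with * show **: "c0 * m * \<Lambda> powr (s - 1) \<le> prime_count n k lam" by (simp add: mult.assoc)
      have "0 < c0 * m * \<Lambda> powr (s - 1)" using c0 m \<Lambda>2 by simp
      with ** show "0 < prime_count n k lam" by linarith
    qed
    have "lp_bounded n p p' (dyadic_sup \<Gamma> \<Lambda> (prime_avg n k))
      ((real (Suc I) powr p' * (real I * (2 powr p' * (2 powr p' * S powr (p' - 2) * \<kappa>\<^sup>2 + V * (2 * H) powr p' * V))
       + V * (S * V / 2 ^ I) powr p') * (2 ^ n) powr (p' / p)) powr (1 / p'))"
    proof (rule prime_avg_lp_bounded_block[where D = D and W = W and M = "main_kernel n k \<psi> (N \<Lambda>) Q", OF _ ne p])
      show "1 \<le> k" using k by simp
      have W: "(2 * \<Lambda>) powr (1 / real k) \<le> real_of_int W" "real_of_int W \<le> (2 * \<Lambda>) powr (1 / real k) + 1"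
        unfolding W_def by linarith+
      have "0 < (2 * \<Lambda>) powr (1 / real k)" using \<Lambda>2 by simp
      then show "0 < W" using W(1) by linarith
      have "((2 * \<Lambda>) powr (1 / real k)) ^ k \<le> real_of_int W ^ k" using W(1) by (intro power_mono) auto
      then show "2 * \<Lambda> \<le> real_of_int W ^ k"
        using \<Lambda>2 k by (simp add: powr_powr flip: powr_realpow)
      have "2 powr (1 / real k) \<le> 2 powr 1" using k by (intro powr_mono) auto
      then have "(2 * \<Lambda>) powr (1 / real k) \<le> 2 * \<Lambda> powr (1 / real k)"
        using \<Lambda>2 by (simp add: powr_mult mult_right_mono)
      \<comment> \<open>W \<le> 2 \<Lambda>^(1/k) + 1 and 1 < \<Lambda>^(1/k): the source of the 6
        in V.\<close>
      then have "2 * real_of_int W \<le> 6 * \<Lambda> powr (1 / real k)" using W(2) root1 by linarith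
      then have "(2 * real_of_int W) ^ n \<le> (6 * \<Lambda> powr (1 / real k)) ^ n"
        using \<open>0 < W\<close> by (intro power_mono) auto
      also have "\<dots> = V" using \<Lambda>2 by (simp add: V_def s_def power_mult_distrib powr_powr flip: powr_realpow)
      finally show "(2 * real_of_int W) ^ n \<le> V" .
      show "0 \<le> D" "0 \<le> H" using cD by (auto simp: D_def H_def cH_def)
      have "H \<le> \<Lambda> powr 1 * \<Lambda> powr (- s)"
        unfolding H_def using elim(8) by (intro mult_right_mono) (auto simp: l_def)
      also have "\<dots> = 1 * \<Lambda> powr (1 - s)" by (simp only: powr_add[symmetric]) simp
      also have "\<dots> \<le> l powr real n * \<Lambda> powr (1 - s)"
        using l1 by (intro mult_right_mono ge_one_powr_ge_zero) auto
      finally show "D + H \<le> S" by (simp add: D_def S_def algebra_simps)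
      fix lam :: nat and x assume lam: "lam \<in> {lam \<in> \<Gamma>. \<Lambda> \<le> real lam \<and> real lam < 2 * \<Lambda>}"
      then have lam': "lam \<in> \<Gamma>" "\<Lambda> \<le> real lam" "real lam < 2 * \<Lambda>" by auto
      note pcl = pcl[OF lam']
      show "cmod (prime_kernel n k lam x) \<le> D"
      proof (cases "x \<in> prime_vecs n k lam")
        case True
        \<comment> \<open>lam < 2 \<Lambda> \<le> \<Lambda>^2 gives ln lam \<le> 2 ln \<Lambda>, the
          source of the 2 ^ n in cD.\<close>
        have "2 * \<Lambda> \<le> \<Lambda> * \<Lambda>" using \<Lambda>2 by (intro mult_right_mono) auto
        then have "real lam \<le> \<Lambda> * \<Lambda>" using lam' by linarith
        then have "ln (real lam) \<le> ln (\<Lambda> * \<Lambda>)" using lam' \<Lambda>2 by (intro ln_mono) auto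
        also have "\<dots> = 2 * l" using \<Lambda>2 by (simp add: ln_mult l_def)
        finally have "ln (real lam) ^ n \<le> (2 * l) ^ n" using lam' \<Lambda>2 by (intro power_mono) auto
        then have "log_weight n x \<le> (2 * l) ^ n"
          using log_weight_le[OF _ True] k by linarith
        then have "log_weight n x / prime_count n k lam \<le> (2 * l) ^ n / (c0 * m * \<Lambda> powr (s - 1))"
          using pcl l1 c0 m \<Lambda>2 by (intro frac_le) auto
        also have "\<dots> = D"
          using \<Lambda>2 l1 by (simp add: D_def cD_def power_mult_distrib powr_realpow powr_diff)
        finally show ?thesis using True cmod_prime_kernel[OF _ pcl(1)] k by simp
      qed (use cD in \<open>simp add: prime_kernel_def D_def\<close>)
      have "cmod (main_kernel n k \<psi> (N \<Lambda>) Q lam x) \<le> 2 * (32 * pi * Q\<^sup>2 / N \<Lambda>) ^ n"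
      proof (rule main_kernel_bound[OF \<psi> _ Q(1) _ pcl(1)])
        show "0 < N \<Lambda>" "1 \<le> k" using N_gt k by auto
        fix f :: "(nat \<Rightarrow> int) \<Rightarrow> complex" and Y L
        assume Y: "finite Y" "Y \<subseteq> int_vecs n" "\<And>y. y \<in> int_vecs n - Y \<Longrightarrow> f y = 0"
          and L: "finite L" "L \<subseteq> int_vecs n"
        have "(\<Sum>l\<in>L. (cmod (error_op n k \<psi> (N \<Lambda>) Q lam f l))\<^sup>2) \<le>
            (\<Sum>l\<in>L. (dyadic_sup \<Gamma> \<Lambda> (error_op n k \<psi> (N \<Lambda>) Q) f l)\<^sup>2)"
          by (intro sum_mono power_mono le_dyadic_sup[OF lam]) auto
        also have "\<dots> \<le> \<kappa>\<^sup>2 * (\<Sum>y\<in>Y. (cmod (f y))\<^sup>2)"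
          by (rule lp_bounded_2_finite_support[OF lp Y L])
        also have "\<dots> \<le> 1 * (\<Sum>y\<in>Y. (cmod (f y))\<^sup>2)"
          using \<kappa>1 by (intro mult_right_mono) (auto intro: sum_nonneg)
        finally show "(\<Sum>l\<in>L. (cmod (error_op n k \<psi> (N \<Lambda>) Q lam f l))\<^sup>2) \<le> (\<Sum>y\<in>Y. (cmod (f y))\<^sup>2)" by simp
      qed
      also have "\<dots> \<le> 2 * (32 * pi * (l powr C)\<^sup>2 / \<Lambda> powr (1 / real k)) ^ n"
        using Q N1 N_gt root1 by (intro mult_left_mono power_mono frac_le) auto
      also have "\<dots> = H"
        using \<Lambda>2 l1
        by (simp add: H_def cH_def h_def s_def power_mult_distrib power_divide powr_powr powr_minus_divide
            mult_ac flip: powr_realpow)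
      finally show "cmod (main_kernel n k \<psi> (N \<Lambda>) Q lam x) \<le> H" .
    next
      show "error_op n k \<psi> (N \<Lambda>) Q lam =
          convolve n (\<lambda>x. prime_kernel n k lam x - main_kernel n k \<psi> (N \<Lambda>) Q lam x)" for lam
        by (simp add: error_op_def)
      show "lp_bounded n 2 2 (dyadic_sup \<Gamma> \<Lambda> (error_op n k \<psi> (N \<Lambda>) Q)) \<kappa>" by (rule lp)
    qed
    moreover have "(real (Suc I) powr p' * (real I * (2 powr p' * (2 powr p' * S powr (p' - 2) * \<kappa>\<^sup>2 + V * (2 * H) powr p' * V))
       + V * (S * V / 2 ^ I) powr p') * (2 ^ n) powr (p' / p)) powr (1 / p')
       \<le> CC * \<Lambda> powr ((1 - s) * (2 / p - 1)) * ln \<Lambda> powr (- B)"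
    proof -
      define X where "X = real (Suc I) powr p' * (real I * (2 powr p' * (2 powr p' * S powr (p' - 2) * \<kappa>\<^sup>2 + V * (2 * H) powr p' * V))
       + V * (S * V / 2 ^ I) powr p')"
      have X0: "0 \<le> X" by (simp add: X_def V_def)
      have Al: "0 \<le> A * l" using A l1 by simp
      have I: "A * l \<le> real I" "real (Suc I) \<le> (A + 2) * l"
        using Al l1 by (auto simp: I_def algebra_simps) linarith+
      have "X \<le> C0 * (\<Lambda> powr ((1 - s) * (p' - 2)) * l powr (- (B * p')))"
        unfolding X_def C0_def l_def
      proof (rule scale_arithmetic[where \<beta> = B1 and h = h and n' = "real n"])
        show "1 < \<Lambda>" using \<Lambda>2 by simp
        show "0 \<le> cD + 1" "0 \<le> cH" using cD by (auto simp: cH_def)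
        show "ln \<Lambda> powr (p' + 1 + h * p' + B * p') \<le> \<Lambda> powr (p' - 2)"
          "ln \<Lambda> powr (p' + real n * p' + B * p') \<le> \<Lambda> powr 1"
          using elim(6,7) by auto
      qed (use p' l1 A B1 I in \<open>auto simp: l_def S_def H_def V_def \<kappa>_def\<close>)
      then have "(X * (2 ^ n) powr (p' / p)) powr (1 / p') \<le>
          (C0 * (\<Lambda> powr ((1 - s) * (p' - 2)) * l powr (- (B * p'))) * (2 ^ n) powr (p' / p)) powr (1 / p')"
        using X0 p' by (intro powr_mono2 mult_right_mono) auto
      also have "\<dots> = CC * (\<Lambda> powr ((1 - s) * (p' - 2) / p') * l powr (- (B * p') / p'))"
      proof -
        have "0 \<le> C0" using A cD by (auto simp: C0_def cH_def)
        then show ?thesis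
          unfolding CC_def by (simp add: powr_mult powr_powr mult_ac)
      qed
      also have "(1 - s) * (p' - 2) / p' = (1 - s) * (2 / p - 1)"
      proof -
        have "1 / p' = 1 - 1 / p" using p by simp
        then have "(p' - 2) / p' = 2 / p - 1" using p' by (simp add: diff_divide_distrib) 
        then show ?thesis by (metis times_divide_eq_right)
      qed
      also have "- (B * p') / p' = - B" using p' by simp
      finally show ?thesis by (simp add: X_def l_def mult.assoc)
    qed
    ultimately show ?case by (rule lp_bounded_mono)
  qed
  then show ?thesis unfolding s_def by (intro exI[of _ CC]) (auto simp: CC_def)
qed

theorem theorem4:
  fixes \<Gamma> :: "nat \<Rightarrow> nat \<Rightarrow> nat set"
    and \<psi> :: "nat \<Rightarrow> (nat \<Rightarrow> real) \<Rightarrow> real"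
    and N :: "real \<Rightarrow> real"
    and n1 :: "nat \<Rightarrow> nat"
    and k n :: nat
    and p p' :: real
  assumes "k \<ge> 2"
    and "n \<ge> n1 k"
    and "\<And>m. m \<ge> n1 k \<Longrightarrow> hua_progression m k (\<Gamma> m k)"
    and "\<And>m. m \<ge> n1 k \<Longrightarrow> cutoff_fun m (\<psi> m)"
    and "admissible_scale k N"
    and "error_threshold \<Gamma> \<psi> N k (n1 k)"
    and "n1 2 = 7"
    and "1 < p" and "p < 2"
    and "1 / p + 1 / p' = 1"
  shows "(k \<ge> 3 \<longrightarrow>
           (\<forall>B>0. \<exists>C. \<forall>\<^sub>F \<Lambda> in at_top.
              lp_bounded n p p' (dyadic_sup (\<Gamma> n k) \<Lambda> (prime_avg n k))
                (C * \<Lambda> powr ((1 - real n / real k) * (2 / p - 1)) * ln \<Lambda> powr (- B)))) \<and>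
         (k = 2 \<longrightarrow>
           (\<exists>C. \<forall>\<^sub>F \<Lambda> in at_top.
              lp_bounded n p p' (dyadic_sup (\<Gamma> n k) \<Lambda> (prime_avg n k))
                (C * \<Lambda> powr ((1 - real n / 2) * (2 / p - 1)) * ln \<Lambda> powr real n)))"
proof -
  have main: "\<exists>C\<ge>0. \<forall>\<^sub>F \<Lambda> in at_top. lp_bounded n p p' (dyadic_sup (\<Gamma> n k) \<Lambda> (prime_avg n k))
                (C * \<Lambda> powr ((1 - real n / real k) * (2 / p - 1)) * ln \<Lambda> powr (- B))" if "B > 0" for B
  proof (rule prime_avg_dyadic_bound[OF assms(1) assms(3)[OF assms(2)] assms(4)[OF assms(2)] assms(5) _ assms(8-10) that])
    show "\<exists>C>0. \<exists>K. \<forall>\<^sub>F \<Lambda> in at_top.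
        lp_bounded n 2 2 (dyadic_sup (\<Gamma> n k) \<Lambda> (error_op n k (\<psi> n) (N \<Lambda>) (ln (N \<Lambda>) powr C))) (K * ln \<Lambda> powr (- B))"
      if "B > 0" for B
      using assms(2,6) that unfolding error_threshold_def by blast
  qed
  show ?thesis
  proof (intro conjI impI allI)
    show "\<exists>C. \<forall>\<^sub>F \<Lambda> in at_top. lp_bounded n p p' (dyadic_sup (\<Gamma> n k) \<Lambda> (prime_avg n k))
                (C * \<Lambda> powr ((1 - real n / real k) * (2 / p - 1)) * ln \<Lambda> powr (- B))" if "B > 0" for B
      using main[OF that] by blast
    assume k: "k = 2"
    \<comment> \<open>From \<Lambda> = exp 1 on, ln \<Lambda> is at least 1, so the gain with B = 1
      is stronger than the factor \<open>ln \<Lambda> powr real n\<close> allowed for k = 2.\<close>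
    obtain C where C: "C \<ge> 0" "\<forall>\<^sub>F \<Lambda> in at_top. lp_bounded n p p' (dyadic_sup (\<Gamma> n k) \<Lambda> (prime_avg n k))
                (C * \<Lambda> powr ((1 - real n / real k) * (2 / p - 1)) * ln \<Lambda> powr (- 1))"
      using main[of 1] by auto
    have "\<forall>\<^sub>F \<Lambda> in at_top. lp_bounded n p p' (dyadic_sup (\<Gamma> n k) \<Lambda> (prime_avg n k))
                (C * \<Lambda> powr ((1 - real n / 2) * (2 / p - 1)) * ln \<Lambda> powr real n)"
      using C(2) eventually_ge_at_top[of "exp 1"]
    proof eventually_elim
      case (elim \<Lambda>)
      have "0 < \<Lambda>" using elim(2) exp_gt_zero[of "1::real"] by linarith
      then have "1 \<le> ln \<Lambda>" using elim(2) by (simp add: ln_ge_iff)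
      then have "ln \<Lambda> powr (- 1) \<le> ln \<Lambda> powr real n" by (intro powr_mono) auto
      then have "C * \<Lambda> powr ((1 - real n / real k) * (2 / p - 1)) * ln \<Lambda> powr (- 1) \<le>
          C * \<Lambda> powr ((1 - real n / 2) * (2 / p - 1)) * ln \<Lambda> powr real n"
        unfolding k of_nat_numeral using C(1) by (intro mult_left_mono) auto
      with elim(1) show ?case by (rule lp_bounded_mono)
    qed
    then show "\<exists>C. \<forall>\<^sub>F \<Lambda> in at_top. lp_bounded n p p' (dyadic_sup (\<Gamma> n k) \<Lambda> (prime_avg n k))
                (C * \<Lambda> powr ((1 - real n / 2) * (2 / p - 1)) * ln \<Lambda> powr real n)" ..
  qed
qed

end
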